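(* Let $N=2$, $k\ge2$, and let $\mathbf{u}=(u_1,\dots,u_k)$ be a nonnegative solution of $-\Delta u_i=-\sum_{j\ne i}u_j^2u_i$ in $\mathbb{R}^2$, $i=1,\dots,k$, such that $N(\mathbf{u},0,+\infty)=:d\in(0,+\infty)$. Then at most $2d$ components of $\mathbf{u}$ do not vanish identically. Equivalently, let $N=2$, $k\ge2$, and let $\mathbf{u}=(u_1,\dots,u_k)$ be a positive solution of the same system such that $N(\mathbf{u},0,+\infty)=:d\in(0,+\infty)$. Then $d\ge k/2$.
   Context: A positive solution has $u_i>0$ in $\mathbb{R}^2$ for every $i$; a nonnegative solution has $u_i\ge0$ for every $i$, where some $u_i$ may vanish identically, but at least two components are non-trivial. In $\mathbb{R}^N$, with $B_r$ the ball of centre $0$ and radius $r$, set $$H(\mathbf{u},0,r):=\frac{1}{r^{N-1}}\int_{\partial B_r}\sum_{i=1}^ku_i^2,\qquad E(\mathbf{u},0,r):=\frac{1}{r^{N-2}}\int_{B_r}\Big(\sum_{i=1}^k|\nabla u_i|^2+\sum_{1\le i<j\le k}u_i^2u_j^2\Big),$$ $$N(\mathbf{u},0,r):=\frac{E(\mathbf{u},0,r)}{H(\mathbf{u},0,r)},$$ which is non-decreasing in $r$, and $N(\mathbf{u},0,+\infty):=\lim_{r\to+\infty}N(\mathbf{u},0,r)$. Here $N=2$. *)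

theory Defs
  imports "HOL-Analysis.Analysis"
begin

definition partial_deriv :: "'n::finite \<Rightarrow> (real^'n \<Rightarrow> real) \<Rightarrow> real^'n \<Rightarrow> real" where
  "partial_deriv i f x = frechet_derivative f (at x) (axis i 1)"

definition gradient :: "(real^'n::finite \<Rightarrow> real) \<Rightarrow> real^'n \<Rightarrow> real^'n" where
  "gradient f x = (\<chi> i. partial_deriv i f x)"

definition laplacian :: "(real^'n::finite \<Rightarrow> real) \<Rightarrow> real^'n \<Rightarrow> real" where
  "laplacian f x = (\<Sum>i\<in>UNIV. partial_deriv i (partial_deriv i f) x)"

definition C2 :: "(real^'n::finite \<Rightarrow> real) \<Rightarrow> bool" where
  "C2 f \<longleftrightarrow>
     (\<forall>x. f differentiable (at x)) \<and>
     (\<forall>i x. partial_deriv i f differentiable (at x)) \<and>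
     (\<forall>i j. continuous_on UNIV (partial_deriv i (partial_deriv j f)))"

text \<open>A system of \<open>k\<close> components is a family \<open>u\<close> of which only the members with index
  in \<open>{1..k}\<close> matter. Solutions are classical, of class \<open>C\<^sup>2\<close> on the whole plane.\<close>

definition solution :: "nat \<Rightarrow> (nat \<Rightarrow> real^2 \<Rightarrow> real) \<Rightarrow> bool" where
  "solution k u \<longleftrightarrow>
     (\<forall>i\<in>{1..k}. C2 (u i)) \<and>
     (\<forall>i\<in>{1..k}. \<forall>x. - laplacian (u i) x = - (\<Sum>j\<in>{1..k} - {i}. (u j x)\<^sup>2 * u i x))"

definition nontrivial_components :: "nat \<Rightarrow> (nat \<Rightarrow> real^2 \<Rightarrow> real) \<Rightarrow> nat set" where
  "nontrivial_components k u = {i\<in>{1..k}. \<exists>x. u i x \<noteq> 0}"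

definition positive_solution :: "nat \<Rightarrow> (nat \<Rightarrow> real^2 \<Rightarrow> real) \<Rightarrow> bool" where
  "positive_solution k u \<longleftrightarrow> solution k u \<and> (\<forall>i\<in>{1..k}. \<forall>x. u i x > 0)"

definition nonnegative_solution :: "nat \<Rightarrow> (nat \<Rightarrow> real^2 \<Rightarrow> real) \<Rightarrow> bool" where
  "nonnegative_solution k u \<longleftrightarrow>
     solution k u \<and> (\<forall>i\<in>{1..k}. \<forall>x. u i x \<ge> 0) \<and> card (nontrivial_components k u) \<ge> 2"

text \<open>The integral over the circle \<open>\<partial>B\<^sub>r\<close> with respect to arc length, whose
  element is \<open>r dt\<close> in the parametrization by the angle \<open>t\<close> (for \<open>r > 0\<close>).\<close>

definition circle_integral :: "real \<Rightarrow> (real^2 \<Rightarrow> real) \<Rightarrow> real" where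
  "circle_integral r f =
     (LINT t:{0..2*pi}|lborel. f (vector [r * cos t, r * sin t]) * r)"

text \<open>In dimension \<open>N = 2\<close> the normalizing factors are
  \<open>1/r\<^bsup>N-1\<^esup> = 1/r\<close> and \<open>1/r\<^bsup>N-2\<^esup> = 1\<close>. All three quantities
  are centred at the origin.\<close>

definition H :: "nat \<Rightarrow> (nat \<Rightarrow> real^2 \<Rightarrow> real) \<Rightarrow> real \<Rightarrow> real" where
  "H k u r = 1 / r * circle_integral r (\<lambda>x. \<Sum>i=1..k. (u i x)\<^sup>2)"

definition E :: "nat \<Rightarrow> (nat \<Rightarrow> real^2 \<Rightarrow> real) \<Rightarrow> real \<Rightarrow> real" where
  "E k u r =
     (LINT x:ball 0 r|lborel.
        (\<Sum>i=1..k. (norm (gradient (u i) x))\<^sup>2) +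
        (\<Sum>i=1..k. \<Sum>j\<in>{i<..k}. (u i x)\<^sup>2 * (u j x)\<^sup>2))"

definition almgren_quotient :: "nat \<Rightarrow> (nat \<Rightarrow> real^2 \<Rightarrow> real) \<Rightarrow> real \<Rightarrow> real" where
  "almgren_quotient k u r = E k u r / H k u r"

end

theory Submission
  imports Defs
begin

text \<open>
  Let \<open>m\<close> be the number of components that do not vanish identically, and let \<open>J\<^sub>i(r)\<close> be the energy of one of
  them, the integral of \<open>|\<nabla>u\<^sub>i|\<^sup>2 + u\<^sub>i\<^sup>2 \<Sum> u\<^sub>j\<^sup>2\<close> (sum over \<open>j \<noteq> i\<close>) over \<open>B\<^sub>r\<close>. By the divergence
  theorem this is the integral of \<open>u\<^sub>i \<partial>\<^sub>\<nu> u\<^sub>i\<close> over \<open>\<partial>B\<^sub>r\<close>. The proof compares an upper and a lower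
  bound for the growth of these energies.

  The upper bound comes from Almgren's formula. Write \<open>K(r)\<close> for the integral over \<open>B\<^sub>r\<close> of the
  interaction \<open>P\<close>, the sum of \<open>u\<^sub>i\<^sup>2 u\<^sub>j\<^sup>2\<close> over \<open>i < j\<close>. The sum of the \<open>J\<^sub>i\<close> is \<open>E + K\<close>, so
  \<open>r H' = 2 (E + K)\<close>, and the quotient \<open>N = E / H\<close> alone does not control \<open>H'\<close>. But the Pohozaev identity
  together with the Cauchy--Schwarz inequality gives more than monotonicity, namely
  \<open>N' \<ge> 2 K / (r H)\<close> (lemma \<open>almgren_derivative\<close>), which is exactly the excess. Hence
  \<open>(log H - N)' \<le> 2 N / r\<close>, and since \<open>N\<close> tends to \<open>d\<close>, both \<open>H\<close> and \<open>E\<close> are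
  \<open>O(r\<^bsup>2(d+e)\<^esup>)\<close> for every \<open>e > 0\<close> (lemma \<open>growth_bound\<close>). Moreover \<open>J\<^sub>i \<le> E\<close>.

  The lower bound is a monotonicity argument of Alt--Caffarelli--Friedman type. The derivative of \<open>J\<^sub>i\<close>
  is at least \<open>2 sqrt (\<Lambda>\<^sub>i) J\<^sub>i / r\<close>, where \<open>\<Lambda>\<^sub>i(r)\<close> is the Rayleigh quotient of \<open>u\<^sub>i\<close> on the circle of
  radius \<open>r\<close>, including the potential \<open>r\<^sup>2 \<Sum> u\<^sub>j\<^sup>2\<close> (lemma \<open>rayleigh_bound\<close>). If the components had
  disjoint supports of lengths \<open>L\<^sub>i\<close> on the circle, then \<open>sqrt (\<Lambda>\<^sub>i) \<ge> \<pi> / L\<^sub>i\<close>, and by convexity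
  the sum of the \<open>sqrt (\<Lambda>\<^sub>i)\<close> would be at least \<open>m\<^sup>2 / 2\<close>. The components do overlap, but their
  \<open>L\<^sup>2\<close> norms on circles are nondecreasing in \<open>r\<close>, so the potential becomes strong as \<open>r\<close> grows and forces
  the superlevel sets of the normalised components apart. Thus the bound holds up to a factor \<open>1 - e\<close> for large \<open>r\<close>
  (lemma \<open>optimal_partition_of_circle\<close>), and the product of the \<open>J\<^sub>i\<close> is at least a constant times
  \<open>r\<close> to the power \<open>(1 - e) m\<^sup>2\<close> (lemma \<open>acf_lower_bound\<close>).

  Comparing exponents, \<open>(1 - e) m\<^sup>2 \<le> 2 m (d + e)\<close>, and \<open>e \<rightarrow> 0\<close> gives \<open>m \<le> 2 d\<close>. A positive solution
  has \<open>m = k\<close>.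

  All of this takes place in polar coordinates, where integration by parts in the angle replaces the divergence
  theorem on discs; the integral over a disc occurs only in \<open>E\<close>.
\<close>

section \<open>Polar coordinates in the plane\<close>

definition polar :: "real \<Rightarrow> real \<Rightarrow> real^2" where
  "polar r t = vector [r * cos t, r * sin t]"

lemma polar_nth [simp]: "polar r t $ 1 = r * cos t" "polar r t $ 2 = r * sin t"
  by (simp_all add: polar_def)

lemma norm_polar: "norm (polar r t) = \<bar>r\<bar>"
proof -
  have "(r * cos t)\<^sup>2 + (r * sin t)\<^sup>2 = r\<^sup>2 * ((sin t)\<^sup>2 + (cos t)\<^sup>2)"
    by (simp add: power_mult_distrib algebra_simps del: sin_cos_squared_add sin_cos_squared_add2)
  then show ?thesis
    by (simp add: norm_vec_def L2_set_def sum_2 del: sin_cos_squared_add2)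
qed

lemma polar_surj:
  obtains t where "0 \<le> t" "t < 2 * pi" "x = polar (norm x) t"
proof (cases "x = 0")
  case True
  then show ?thesis using that[of 0] by (simp add: polar_def vec_eq_iff forall_2)
next
  case False
  have n: "(norm x)\<^sup>2 = (x$1)\<^sup>2 + (x$2)\<^sup>2"
    by (simp add: norm_vec_def L2_set_def sum_2)
  have "(x$1 / norm x)\<^sup>2 + (x$2 / norm x)\<^sup>2 = 1"
    using False n[symmetric] by (simp add: power_divide flip: add_divide_distrib)
  then obtain t where "0 \<le> t" "t < 2*pi" "x$1 / norm x = cos t" "x$2 / norm x = sin t"
    by (rule sincos_total_2pi)
  moreover have "polar (norm x) t $ i = x $ i" for i
    using calculation(3,4) False exhaust_2[of i] by (auto simp: field_simps)
  ultimately show ?thesis using that[of t] by (simp add: vec_eq_iff)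
qed

lemma polar_inj:
  assumes "polar r t = polar s t'" "0 < r" "0 < s" "0 < t" "t < 2*pi" "0 < t'" "t' < 2*pi"
  shows "r = s \<and> t = t'"
proof -
  have rs: "r = s" using norm_polar[of r t] norm_polar[of s t'] assms by simp
  then have "sin t = sin t'" "cos t = cos t'"
    using assms by (auto simp: vec_eq_iff forall_2)
  then obtain n :: int where n: "t = t' + 2 * pi * n"
    using sin_cos_eq_iff by blast
  have "\<bar>2 * pi * n\<bar> < 2 * pi * 1" using n assms by linarith
  then have "\<bar>real_of_int n\<bar> < 1"
    by (simp add: abs_mult)
  then have "n = 0" by linarith
  then show ?thesis using rs n by simp
qed

lemma continuous_on_polar [continuous_intros]:
  fixes S :: "'a::t2_space set"
  assumes "continuous_on S a" "continuous_on S b"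
  shows "continuous_on S (\<lambda>p. polar (a p) (b p))"
proof -
  have "polar r t = (r * cos t) *\<^sub>R axis 1 1 + (r * sin t) *\<^sub>R axis 2 1" for r t
    by (simp add: vec_eq_iff forall_2 axis_def)
  then show ?thesis using assms by (auto intro!: continuous_intros)
qed

lemma exists_2: "(\<exists>i::2. P i) \<longleftrightarrow> P 1 \<or> P 2"
  by (metis exhaust_2)

text \<open>Fubini is available for pairs, so the rectangle is carried over by the volume-preserving
  coordinate map.\<close>

lemma integral_real2_prod:
  fixes F :: "real \<times> real \<Rightarrow> real"
  assumes "continuous_on UNIV F"
  shows "integral (cbox (vector [a, b]) (vector [c, d]) :: (real^2) set) (\<lambda>p. F (p$1, p$2))
       = integral {a..c} (\<lambda>s. integral {b..d} (\<lambda>t. F (s, t)))"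
proof -
  let ?g = "\<lambda>p::real^2. (p$1, p$2)" and ?h = "\<lambda>q::real\<times>real. vector [fst q, snd q] :: real^2"
  have gi: "?g ` cbox u v = cbox (?g u) (?g v)" for u v
  proof (intro set_eqI iffI)
    fix q assume "q \<in> cbox (?g u) (?g v)"
    then have "?h q \<in> cbox u v" "?g (?h q) = q"
      by (auto simp: cbox_Pair_eq mem_box_cart forall_2)
    then show "q \<in> ?g ` cbox u v" by (metis (no_types, lifting) image_eqI)
  qed (auto simp: cbox_Pair_eq mem_box_cart)
  have hi: "?h ` cbox u v = cbox (?h u) (?h v)" for u v
  proof (intro set_eqI iffI)
    fix p assume "p \<in> cbox (?h u) (?h v)"
    then have "?g p \<in> cbox u v" "?h (?g p) = p"
      by (cases u, cases v, auto simp: cbox_Pair_eq mem_box_cart forall_2 vec_eq_iff)+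
    then show "p \<in> ?h ` cbox u v" by (metis (no_types, lifting) image_eqI)
  qed (cases u, cases v, auto simp: cbox_Pair_eq mem_box_cart forall_2)
  have i: "(F has_integral integral (cbox (a,b) (c,d)) F) (cbox (a,b) (c,d))"
    by (intro integrable_integral integrable_continuous continuous_on_subset[OF assms]) auto
  have "((\<lambda>p. F (?g p)) has_integral (1 / 1) *\<^sub>R integral (cbox (a,b) (c,d)) F) (?h ` cbox (a,b) (c,d))"
  proof (rule has_integral_twiddle[where g = ?g and h = ?h, OF _ _ _ _ _ _ _ i])
    show "measure lborel (?g ` cbox u v) = 1 * measure lborel (cbox u v)" for u v :: "real^2"
      unfolding gi content_Pair
      using exists_2[of "\<lambda>i. v $ i < u $ i"]
      by (auto simp: content_cbox_if_cart interval_eq_empty_cart content_real_if UNIV_2)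
  qed (auto simp: gi hi vec_eq_iff forall_2 intro!: continuous_intros)
  then have "integral (cbox (vector [a, b]) (vector [c, d]) :: (real^2) set) (\<lambda>p. F (p$1, p$2)) 
     = integral (cbox (a,b) (c,d)) F"
    unfolding hi by (simp add: integral_unique)
  also have "\<dots> = integral {a..c} (\<lambda>s. integral {b..d} (\<lambda>t. F (s, t)))"
    using integral_prod_continuous[of a b c d F] continuous_on_subset[OF assms] by simp
  finally show ?thesis .
qed

lemma polar_has_derivative:
  "((\<lambda>p::real^2. polar (p$1) (p$2)) has_derivative
    (\<lambda>h. vector [cos (q$2) * h$1 - q$1 * sin (q$2) * h$2, sin (q$2) * h$1 + q$1 * cos (q$2) * h$2])) (at q within S)"
proof -
  have nth: "((\<lambda>p::real^2. p $ i) has_derivative (\<lambda>h. h $ i)) (at q within S)" for i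
    by (rule bounded_linear_imp_has_derivative) (rule bounded_linear_vec_nth)
  have "((\<lambda>p::real^2. (p$1 * cos (p$2)) *\<^sub>R (axis 1 1 :: real^2) + (p$1 * sin (p$2)) *\<^sub>R axis 2 1) has_derivative
    (\<lambda>h. (cos (q$2) * h$1 - q$1 * sin (q$2) * h$2) *\<^sub>R axis 1 1 + (sin (q$2) * h$1 + q$1 * cos (q$2) * h$2) *\<^sub>R axis 2 1)) (at q within S)"
    by (rule derivative_eq_intros nth refl | simp add: fun_eq_iff algebra_simps)+
  moreover have "polar r t = (r * cos t) *\<^sub>R axis 1 1 + (r * sin t) *\<^sub>R axis 2 1" for r t
    by (simp add: vec_eq_iff forall_2 axis_def)
  moreover have "vector [a, b] = a *\<^sub>R axis 1 1 + b *\<^sub>R (axis 2 1 :: real^2)" for a b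
    by (simp add: vec_eq_iff forall_2 axis_def)
  ultimately show ?thesis by simp
qed

text \<open>On the open rectangle the polar map is injective, and it covers the disc except for a
  part of the line \<open>x\<^sub>2 = 0\<close>, which is negligible. The Jacobian determinant is the radius.\<close>

lemma integral_ball_polar:
  fixes f :: "real^2 \<Rightarrow> real"
  assumes f: "continuous_on UNIV f" and r: "0 < r"
  shows "(LINT x:ball 0 r|lborel. f x) = integral {0..r} (\<lambda>s. integral {0..2*pi} (\<lambda>t. s * f (polar s t)))"
proof -
  let ?P = "\<lambda>p::real^2. polar (p$1) (p$2)"
  let ?P' = "\<lambda>q h. vector [cos (q$2) * h$1 - q$1 * sin (q$2) * h$2, sin (q$2) * h$1 + q$1 * cos (q$2) * h$2] :: real^2"
  let ?D = "\<lambda>x::real^2. \<bar>det (matrix (?P' x))\<bar>"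
  let ?S = "box (vector [0, 0]) (vector [r, 2*pi]) :: (real^2) set"
  have det: "?D p = \<bar>p$1\<bar>" for p
  proof -
    have "det (matrix (?P' p)) = cos (p$2) * (p$1 * cos (p$2)) + p$1 * sin (p$2) * sin (p$2)"
      by (simp add: det_2 matrix_def axis_def)
    also have "\<dots> = p$1 * ((sin (p$2))\<^sup>2 + (cos (p$2))\<^sup>2)"
      by algebra
    also have "\<dots> = p$1"
      by simp
    finally show ?thesis by simp
  qed
  have S: "?S = {p. 0 < p$1 \<and> p$1 < r \<and> 0 < p$2 \<and> p$2 < 2*pi}"
    by (auto simp: mem_box_cart forall_2)
  have inj: "inj_on ?P ?S"
  proof (rule inj_onI)
    fix p q assume pq: "p \<in> ?S" "q \<in> ?S" "?P p = ?P q"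
    then have "p$1 = q$1 \<and> p$2 = q$2" by (intro polar_inj) (auto simp: S)
    then show "p = q" by (simp add: vec_eq_iff forall_2)
  qed
  have sub1: "?P ` ?S \<subseteq> ball 0 r"
    by (auto simp: S norm_polar)
  have sub2: "ball 0 r - ?P ` ?S \<subseteq> {x. x$2 = 0}"
  proof
    fix x assume x: "x \<in> ball 0 r - ?P ` ?S"
    obtain t where t: "0 \<le> t" "t < 2 * pi" "x = polar (norm x) t"
      by (rule polar_surj)
    show "x \<in> {x. x$2 = 0}"
    proof (rule ccontr)
      assume n: "x \<notin> {x. x$2 = 0}"
      have "x$2 = norm x * sin t" by (subst t(3)) simp
      with n have "t \<noteq> 0" "norm x \<noteq> 0" by auto
      then have "vector [norm x, t] \<in> ?S" using t(1,2) x by (auto simp: S)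
      then have "?P (vector [norm x, t]) \<in> ?P ` ?S" by (rule imageI)
      then have "x \<in> ?P ` ?S" by (simp only: vector_2 t(3)[symmetric])
      with x show False by simp
    qed
  qed
  have neg: "negligible {x \<in> ball 0 r - ?P ` ?S. f x \<noteq> 0}" "negligible {x \<in> ?P ` ?S - ball 0 r. f x \<noteq> 0}"
    by (rule negligible_subset[OF negligible_standard_hyperplane_cart[of 2]]; use sub1 sub2 in blast)+
  have "set_integrable lborel (cball 0 r) f"
    unfolding set_integrable_def by (rule borel_integrable_compact) (auto intro: continuous_on_subset[OF f])
  then have fb: "set_integrable lborel (ball 0 r) f"
    by (rule set_integrable_subset) auto
  then have fi: "f absolutely_integrable_on ball 0 r"
    by (auto simp: set_integrable_def integrable_completion)
  have "(\<lambda>x. ?D x *\<^sub>R vec (f (?P x)) :: real^1) absolutely_integrable_on ?S \<and>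
        integral ?S (\<lambda>x. ?D x *\<^sub>R vec (f (?P x)) :: real^1) = vec (integral (ball 0 r) f) \<longleftrightarrow>
        (\<lambda>x. vec (f x) :: real^1) absolutely_integrable_on (?P ` ?S) \<and> integral (?P ` ?S) (\<lambda>x. vec (f x) :: real^1) = vec (integral (ball 0 r) f)"
    by (rule has_absolute_integral_change_of_variables[OF _ polar_has_derivative inj]) auto
  moreover have "integral (?P ` ?S) f = integral (ball 0 r) f"
    using integral_spike_set[OF neg] by simp
  moreover have "f absolutely_integrable_on (?P ` ?S)"
    by (rule absolutely_integrable_spike_set[OF fi neg])
  ultimately have "integral (ball 0 r) f = integral ?S (\<lambda>p. \<bar>p$1\<bar> * f (?P p))"
    by (simp add: absolutely_integrable_on_1_iff integral_on_1_eq det)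
  also have "\<dots> = integral (cbox (vector [0, 0]) (vector [r, 2*pi])) (\<lambda>p::real^2. \<bar>p$1\<bar> * f (?P p))"
    by (simp add: integral_open_interval)
  also have "\<dots> = integral {0..r} (\<lambda>s. integral {0..2*pi} (\<lambda>t. \<bar>s\<bar> * f (polar s t)))"
  proof -
    have "continuous_on UNIV (\<lambda>p. \<bar>fst p\<bar> * f (polar (fst p) (snd p)))"
      by (auto intro!: continuous_intros continuous_on_compose2[OF f])
    then show ?thesis
      using integral_real2_prod[of "\<lambda>p. \<bar>fst p\<bar> * f (polar (fst p) (snd p))" 0 0 r "2*pi"] by simp
  qed
  also have "\<dots> = integral {0..r} (\<lambda>s. integral {0..2*pi} (\<lambda>t. s * f (polar s t)))"
    by (intro integral_cong) auto
  finally show ?thesis using set_borel_integral_eq_integral(2)[OF fb] by simp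
qed

section \<open>Functions on the circle\<close>

definition cint :: "(real \<Rightarrow> real) \<Rightarrow> real" where
  "cint f = integral {0..2*pi} f"

lemma cint_integrable: "continuous_on UNIV f \<Longrightarrow> f integrable_on {a..b}" for f :: "real \<Rightarrow> real"
  by (rule integrable_continuous_real) (rule continuous_on_subset, auto)

lemma cint_add: "continuous_on UNIV f \<Longrightarrow> continuous_on UNIV g \<Longrightarrow> cint (\<lambda>t. f t + g t) = cint f + cint g"
  unfolding cint_def by (intro integral_add cint_integrable)

lemma cint_diff: "continuous_on UNIV f \<Longrightarrow> continuous_on UNIV g \<Longrightarrow> cint (\<lambda>t. f t - g t) = cint f - cint g"
  unfolding cint_def by (intro integral_diff cint_integrable)

lemma cint_cmult: "cint (\<lambda>t. c * f t) = c * cint f"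
  unfolding cint_def by simp

lemma cint_const: "cint (\<lambda>t. c) = 2 * pi * c"
  unfolding cint_def by simp

lemma cint_sum:
  "(\<And>i. i \<in> A \<Longrightarrow> continuous_on UNIV (f i)) \<Longrightarrow> cint (\<lambda>t. \<Sum>i\<in>A. f i t) = (\<Sum>i\<in>A. cint (f i))"
  unfolding cint_def by (cases "finite A") (simp_all add: integral_sum cint_integrable)

lemma cint_mono:
  "continuous_on UNIV f \<Longrightarrow> continuous_on UNIV g \<Longrightarrow> (\<And>t. t \<in> {0..2*pi} \<Longrightarrow> f t \<le> g t) \<Longrightarrow> cint f \<le> cint g"
  unfolding cint_def by (intro integral_le cint_integrable) auto

lemma cint_nonneg: "continuous_on UNIV f \<Longrightarrow> (\<And>t. t \<in> {0..2*pi} \<Longrightarrow> 0 \<le> f t) \<Longrightarrow> 0 \<le> cint f"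
  unfolding cint_def by (intro integral_nonneg cint_integrable) auto

lemma continuous_on_if_deriv:
  fixes f f' :: "real \<Rightarrow> real"
  assumes "\<And>x. (f has_real_derivative f' x) (at x)"
  shows "continuous_on UNIV f"
  using assms by (meson DERIV_isCont continuous_at_imp_continuous_on)

lemma pos_part_square_deriv:
  "((\<lambda>x. (max 0 x)\<^sup>2) has_real_derivative 2 * max 0 x) (at x)" for x :: real
proof (cases "x = 0")
  case False
  show ?thesis
  proof (cases "x > 0")
    case True
    have "((\<lambda>x. x\<^sup>2) has_real_derivative 2 * max 0 x) (at x)"
      using True by (auto intro!: derivative_eq_intros)
    then show ?thesis
      by (rule has_field_derivative_transform_within_open[of _ _ _ "{0<..}"]) (use True in auto)
  next
    case x: False
    have "((\<lambda>x. 0) has_real_derivative 2 * max 0 x) (at x)"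
      using x by auto
    then show ?thesis
      by (rule has_field_derivative_transform_within_open[of _ _ _ "{..<0}"]) (use x False in auto)
  qed
next
  case True
  have "((\<lambda>h::real. (max 0 h)\<^sup>2 / h) \<longlongrightarrow> 0) (at 0)"
  proof (rule Lim_null_comparison)
    show "\<forall>\<^sub>F h::real in at 0. norm ((max 0 h)\<^sup>2 / h) \<le> \<bar>h\<bar>"
      by (intro always_eventually allI) (auto simp: max_def power2_eq_square)
    show "((\<lambda>h::real. \<bar>h\<bar>) \<longlongrightarrow> 0) (at 0)"
      by (intro tendsto_eq_intros) auto
  qed
  then show ?thesis using True by (simp add: DERIV_def)
qed

text \<open>The integrand dominates the derivative of \<open>a w\<^sup>2 cot \<psi>\<close>, where \<open>w = (v - c)\<^sup>+\<close>, because the difference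
  is the square of \<open>v' - a w cot \<psi>\<close>. The phase \<open>\<psi>\<close> has to advance at speed \<open>a\<close> only where \<open>w > 0\<close>; so it
  may stay within \<open>(0, \<pi>)\<close> on a long interval when \<open>w\<close> lives on a short part of it.\<close>

lemma calibration_inequality:
  fixes v v' \<rho> \<psi> :: "real \<Rightarrow> real"
  assumes pq: "p \<le> q"
    and v: "\<And>t. (v has_real_derivative v' t) (at t)" and v': "continuous_on UNIV v'"
    and \<psi>: "\<And>t. t \<in> {p..q} \<Longrightarrow> (\<psi> has_real_derivative a * \<rho> t) (at t within {p..q})"
    and \<psi>_range: "\<And>t. t \<in> {p..q} \<Longrightarrow> 0 < \<psi> t \<and> \<psi> t < pi"
    and \<rho>: "\<And>t. c < v t \<Longrightarrow> \<rho> t = 1"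
  shows "a * (max 0 (v q - c))\<^sup>2 * cot (\<psi> q) - a * (max 0 (v p - c))\<^sup>2 * cot (\<psi> p)
         \<le> integral {p..q} (\<lambda>t. (v' t)\<^sup>2 - a\<^sup>2 * (max 0 (v t - c))\<^sup>2)"
proof -
  define w where "w t = max 0 (v t - c)" for t
  define G' where "G' t = 2 * w t * v' t * a * cot (\<psi> t) - a\<^sup>2 * (w t)\<^sup>2 * (1 + (cot (\<psi> t))\<^sup>2)" for t
  have sn: "sin (\<psi> t) \<noteq> 0" if "t \<in> {p..q}" for t
    using \<psi>_range[OF that] sin_gt_zero by force
  have contv: "continuous_on UNIV v"
    by (rule continuous_on_if_deriv[OF v])
  have "(G' has_integral a * (w q)\<^sup>2 * cot (\<psi> q) - a * (w p)\<^sup>2 * cot (\<psi> p)) {p..q}"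
  proof (rule fundamental_theorem_of_calculus[OF pq])
    fix t assume t: "t \<in> {p..q}"
    have "((\<lambda>t. (w t)\<^sup>2) has_real_derivative 2 * w t * v' t) (at t within {p..q})"
      unfolding w_def
      by (rule has_field_derivative_at_within, rule DERIV_chain2[OF pos_part_square_deriv])
         (auto intro!: derivative_eq_intros v)
    moreover have "((\<lambda>t. cot (\<psi> t)) has_real_derivative - inverse ((sin (\<psi> t))\<^sup>2) * (a * \<rho> t)) (at t within {p..q})"
      by (rule DERIV_chain2[OF DERIV_cot \<psi>]) (use sn t in auto)
    ultimately have "((\<lambda>t. a * (w t)\<^sup>2 * cot (\<psi> t)) has_real_derivative
        (a * (2 * w t * v' t)) * cot (\<psi> t) + (- inverse ((sin (\<psi> t))\<^sup>2) * (a * \<rho> t)) * (a * (w t)\<^sup>2)) (at t within {p..q})"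
      by (intro DERIV_mult DERIV_cmult)
    moreover have "\<rho> t * (w t)\<^sup>2 = (w t)\<^sup>2"
      using \<rho>[of t] by (cases "c < v t") (auto simp: w_def)
    moreover have "inverse ((sin (\<psi> t))\<^sup>2) = 1 + (cot (\<psi> t))\<^sup>2"
      using sn[OF t] sin_cos_squared_add[of "\<psi> t"] by (simp add: cot_def field_simps)
    ultimately have "((\<lambda>t. a * (w t)\<^sup>2 * cot (\<psi> t)) has_real_derivative G' t) (at t within {p..q})"
      unfolding G'_def by (elim DERIV_cong) algebra
    then show "((\<lambda>t. a * (w t)\<^sup>2 * cot (\<psi> t)) has_vector_derivative G' t) (at t within {p..q})"
      by (simp add: has_real_derivative_iff_has_vector_derivative)
  qed
  moreover have "((\<lambda>t. (v' t)\<^sup>2 - a\<^sup>2 * (w t)\<^sup>2) has_integral integral {p..q} (\<lambda>t. (v' t)\<^sup>2 - a\<^sup>2 * (w t)\<^sup>2)) {p..q}"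
    unfolding w_def by (intro integrable_integral cint_integrable continuous_intros v' contv)
  moreover have "G' t \<le> (v' t)\<^sup>2 - a\<^sup>2 * (w t)\<^sup>2" for t
  proof -
    have "0 \<le> (v' t - a * w t * cot (\<psi> t))\<^sup>2" by simp
    then show ?thesis unfolding G'_def by (simp add: power2_eq_square algebra_simps)
  qed
  ultimately show ?thesis unfolding w_def by (rule has_integral_le)
qed

text \<open>The eigenvalue estimate \<open>(\<pi> / L)\<^sup>2\<close> for functions supported on a set of length \<open>L\<close>. A continuous weight
  \<open>\<rho>\<close> that is 1 on the support plays the role of its indicator, so that the phase built from its primitive is
  differentiable everywhere. The phase starts at a zero \<open>t0\<close> of \<open>(v - c)\<^sup>+\<close> and runs once around the circle, which
  cuts \<open>[0, 2\<pi>]\<close> into two calibrated pieces whose boundary terms cancel by periodicity.\<close>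

lemma poincare_superlevel:
  fixes v v' \<rho> :: "real \<Rightarrow> real"
  assumes v: "\<And>t. (v has_real_derivative v' t) (at t)" and v': "continuous_on UNIV v'"
    and per: "v (2*pi) = v 0"
    and \<rho>: "continuous_on UNIV \<rho>" "\<And>t. 0 \<le> \<rho> t" "\<And>t. c < v t \<Longrightarrow> \<rho> t = 1"
    and t0: "t0 \<in> {0..2*pi}" "v t0 \<le> c"
    and a: "0 < a" "a * cint \<rho> < pi"
  shows "a\<^sup>2 * cint (\<lambda>t. (max 0 (v t - c))\<^sup>2) \<le> cint (\<lambda>t. (v' t)\<^sup>2)"
proof -
  define \<phi> where "\<phi> t = integral {0..t} \<rho>" for t
  define L where "L = cint \<rho>"
  \<comment> \<open>The total phase advance \<open>a L\<close> is less than \<open>\<pi>\<close>; this offset keeps the phase away from both ends of \<open>(0, \<pi>)\<close>.\<close>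
  define e where "e = (pi - a * L) / 2"
  define F where "F t = (v' t)\<^sup>2 - a\<^sup>2 * (max 0 (v t - c))\<^sup>2" for t
  have contv: "continuous_on UNIV v"
    by (rule continuous_on_if_deriv[OF v])
  have F: "continuous_on UNIV F"
    unfolding F_def by (intro continuous_intros v' contv)
  have e: "0 < e" "a * L + e < pi" using a by (auto simp: e_def L_def field_simps)
  have \<phi>': "(\<phi> has_real_derivative \<rho> t) (at t within S)" if "t \<in> {0..2*pi}" "S \<subseteq> {0..2*pi}" for t S
    unfolding \<phi>_def
    by (rule DERIV_subset[OF integral_has_real_derivative that(2)]) (use that in \<open>auto intro: continuous_on_subset[OF \<rho>(1)]\<close>)
  have mono: "\<phi> s \<le> \<phi> t" if "s \<le> t" "0 \<le> s" for s t
    unfolding \<phi>_def by (intro integral_subset_le cint_integrable \<rho>) (use that \<rho> in auto)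
  have \<phi>0: "\<phi> 0 = 0" and \<phi>2: "\<phi> (2*pi) = L" by (auto simp: \<phi>_def L_def cint_def)
  let ?\<psi>1 = "\<lambda>t. a * (\<phi> t + (L - \<phi> t0)) + e" and ?\<psi>2 = "\<lambda>t. a * (\<phi> t - \<phi> t0) + e"
  have t0': "0 \<le> t0" "t0 \<le> 2*pi" using t0 by auto
  have b: "0 \<le> \<phi> t0" "\<phi> t0 \<le> L" using mono[of 0 t0] mono[of t0 "2*pi"] t0' \<phi>0 \<phi>2 by auto
  have range: "0 < a * x + e \<and> a * x + e < pi" if "0 \<le> x" "x \<le> L" for x
    using e a that mult_left_mono[of x L a] mult_nonneg_nonneg[of a x] by linarith
  have 1: "a * (max 0 (v t0 - c))\<^sup>2 * cot (?\<psi>1 t0) - a * (max 0 (v 0 - c))\<^sup>2 * cot (?\<psi>1 0) \<le> integral {0..t0} F"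
    unfolding F_def
  proof (rule calibration_inequality[OF t0'(1) v v', where \<rho> = \<rho>])
    fix t assume t: "t \<in> {0..t0}"
    show "(?\<psi>1 has_real_derivative a * \<rho> t) (at t within {0..t0})"
      using t t0' by (auto intro!: derivative_eq_intros \<phi>')
    show "0 < ?\<psi>1 t \<and> ?\<psi>1 t < pi"
      using t t0' b mono[of 0 t] mono[of t t0] \<phi>0 by (intro range) auto
  qed (use \<rho> in auto)
  have 2: "a * (max 0 (v (2*pi) - c))\<^sup>2 * cot (?\<psi>2 (2*pi)) - a * (max 0 (v t0 - c))\<^sup>2 * cot (?\<psi>2 t0) \<le> integral {t0..2*pi} F"
    unfolding F_def
  proof (rule calibration_inequality[OF t0'(2) v v', where \<rho> = \<rho>])
    fix t assume t: "t \<in> {t0..2*pi}"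
    show "(?\<psi>2 has_real_derivative a * \<rho> t) (at t within {t0..2*pi})"
      using t t0' by (auto intro!: derivative_eq_intros \<phi>')
    show "0 < ?\<psi>2 t \<and> ?\<psi>2 t < pi"
      using t t0' b mono[of t0 t] mono[of t "2*pi"] \<phi>2 by (intro range) auto
  qed (use \<rho> in auto)
  have "integral {0..t0} F + integral {t0..2*pi} F = cint F"
    unfolding cint_def using t0' by (intro Henstock_Kurzweil_Integration.integral_combine cint_integrable F)
  moreover have "?\<psi>1 0 = ?\<psi>2 (2*pi)" using \<phi>0 \<phi>2 by (simp add: algebra_simps)
  moreover have "max 0 (v t0 - c) = 0" using t0 by simp
  ultimately have "0 \<le> cint F" using 1 2 unfolding per
    by (simp only: power_zero_numeral mult_zero_left mult_zero_right) 
  also have "cint F = cint (\<lambda>t. (v' t)\<^sup>2) - a\<^sup>2 * cint (\<lambda>t. (max 0 (v t - c))\<^sup>2)"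
    unfolding F_def by (subst cint_diff) (auto intro!: continuous_intros v' contv simp: cint_cmult)
  finally show ?thesis by simp
qed

text \<open>The Hoelder estimate for functions with square-integrable derivative, in the linearised form that
  \<open>|v'| \<le> \<alpha> v'\<^sup>2 / 2 + 1 / (2 \<alpha>)\<close> gives without the Cauchy--Schwarz inequality.\<close>

lemma oscillation_bound:
  fixes v v' :: "real \<Rightarrow> real"
  assumes v: "\<And>t. (v has_real_derivative v' t) (at t)" and v': "continuous_on UNIV v'"
    and M: "cint (\<lambda>t. (v' t)\<^sup>2) \<le> M" and \<alpha>: "0 < \<alpha>"
    and st: "s \<in> {0..2*pi}" "t \<in> {0..2*pi}"
  shows "\<bar>v t - v s\<bar> \<le> \<alpha> * M / 2 + \<bar>t - s\<bar> / (2 * \<alpha>)"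
proof -
  have *: "\<bar>v t - v s\<bar> \<le> \<alpha> * M / 2 + (t - s) / (2 * \<alpha>)"
    if le: "s \<le> t" and st: "s \<in> {0..2*pi}" "t \<in> {0..2*pi}" for s t
  proof -
    have hv: "(v' has_integral v t - v s) {s..t}"
      by (rule fundamental_theorem_of_calculus[OF le])
         (use v in \<open>auto simp: has_real_derivative_iff_has_vector_derivative[symmetric] intro: has_field_derivative_at_within\<close>)
    have c: "((\<lambda>x. \<alpha>/2 * (v' x)\<^sup>2 + 1 / (2*\<alpha>)) has_integral
        integral {s..t} (\<lambda>x. \<alpha>/2 * (v' x)\<^sup>2 + 1 / (2*\<alpha>))) {s..t}"
      by (intro integrable_integral cint_integrable continuous_intros v') (use \<alpha> in auto)
    have ab: "\<bar>v' x\<bar> \<le> \<alpha>/2 * (v' x)\<^sup>2 + 1 / (2*\<alpha>)" for x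
    proof -
      have "0 \<le> (\<alpha> * \<bar>v' x\<bar> - 1)\<^sup>2 / (2*\<alpha>)" using \<alpha> by simp
      also have "\<dots> = \<alpha>/2 * (v' x)\<^sup>2 + 1 / (2*\<alpha>) - \<bar>v' x\<bar>"
        using \<alpha> by (simp add: power2_eq_square field_simps)
      finally show ?thesis by simp
    qed
    have "v t - v s \<le> integral {s..t} (\<lambda>x. \<alpha>/2 * (v' x)\<^sup>2 + 1 / (2*\<alpha>))"
      by (rule has_integral_le[OF hv c]) (rule order_trans[OF abs_ge_self ab])
    moreover have "- (v t - v s) \<le> integral {s..t} (\<lambda>x. \<alpha>/2 * (v' x)\<^sup>2 + 1 / (2*\<alpha>))"
      by (rule has_integral_le[OF has_integral_neg[OF hv] c]) (rule order_trans[OF abs_ge_minus_self ab])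
    moreover have "integral {s..t} (\<lambda>x. \<alpha>/2 * (v' x)\<^sup>2 + 1 / (2*\<alpha>))
        = \<alpha>/2 * integral {s..t} (\<lambda>x. (v' x)\<^sup>2) + (t - s) / (2*\<alpha>)"
      using le by (subst integral_add) (auto intro!: cint_integrable continuous_intros v')
    moreover have "integral {s..t} (\<lambda>x. (v' x)\<^sup>2) \<le> cint (\<lambda>t. (v' t)\<^sup>2)"
      unfolding cint_def using st by (intro integral_subset_le cint_integrable continuous_intros v') auto
    moreover from this M \<alpha> have "\<alpha>/2 * integral {s..t} (\<lambda>x. (v' x)\<^sup>2) \<le> \<alpha>/2 * M"
      by (intro mult_left_mono) auto
    ultimately show ?thesis by (simp add: abs_le_iff)
  qed
  show ?thesis
    using *[of s t] *[of t s] st by (cases "s \<le> t") auto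
qed

text \<open>Two functions with bounded Dirichlet energy that exceed \<open>\<delta>\<close> at a common point still exceed \<open>\<delta> / 2\<close> on an
  interval of definite length, so their overlap integral cannot be small.\<close>

lemma overlap_bound:
  fixes v v' w w' :: "real \<Rightarrow> real"
  assumes v: "\<And>t. (v has_real_derivative v' t) (at t)" and v': "continuous_on UNIV v'"
    and w: "\<And>t. (w has_real_derivative w' t) (at t)" and w': "continuous_on UNIV w'"
    and M: "cint (\<lambda>t. (v' t)\<^sup>2) \<le> M" "cint (\<lambda>t. (w' t)\<^sup>2) \<le> M" "0 < M"
    and \<delta>: "0 < \<delta>" "\<delta> < v t0" "\<delta> < w t0" and t0: "t0 \<in> {0..2*pi}"
    and l: "0 < l" "l \<le> \<delta>\<^sup>2 / (4 * M)" "l \<le> pi"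
  shows "l * (\<delta>/2)^4 \<le> cint (\<lambda>t. (v t)\<^sup>2 * (w t)\<^sup>2)"
proof -
  have low: "(\<delta>/2) \<le> f t" if f: "\<And>t. (f has_real_derivative f' t) (at t)" "continuous_on UNIV f'"
    "cint (\<lambda>t. (f' t)\<^sup>2) \<le> M" "\<delta> < f t0" and t: "t \<in> {0..2*pi}" "\<bar>t - t0\<bar> \<le> l" for f f' t
  proof -
    have "\<bar>f t - f t0\<bar> \<le> \<delta>/(2*M) * M / 2 + \<bar>t - t0\<bar> / (2 * (\<delta>/(2*M)))"
      by (rule oscillation_bound[OF f(1-3) _ t0 t(1)]) (use \<delta>(1) M(3) in simp)
    also have "\<dots> \<le> \<delta>/(2*M) * M / 2 + (\<delta>\<^sup>2 / (4 * M)) / (2 * (\<delta>/(2*M)))"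
      using t l \<delta>(1) M(3) by (intro add_mono divide_right_mono) auto
    also have "\<dots> = \<delta> / 2" using \<delta>(1) M(3) by (simp add: field_simps power2_eq_square)
    finally show ?thesis using f(4) by linarith
  qed
  have cv: "continuous_on UNIV v" "continuous_on UNIV w"
    by (rule continuous_on_if_deriv[OF v], rule continuous_on_if_deriv[OF w])
  \<comment> \<open>An interval of length \<open>l \<le> \<pi>\<close> with endpoint \<open>t0\<close> fits into \<open>[0, 2\<pi>]\<close> on at least one side.\<close>
  obtain p where p: "0 \<le> p" "p + l \<le> 2*pi" "p = t0 \<or> p = t0 - l"
  proof (cases "t0 + l \<le> 2*pi")
    case True then show ?thesis using that[of t0] t0 by auto
  next
    case False then show ?thesis using that[of "t0 - l"] t0 l by auto
  qed
  have "l * (\<delta>/2)^4 = integral {p..p+l} (\<lambda>t. (\<delta>/2)^4)"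
    using l by simp
  also have "\<dots> \<le> integral {p..p+l} (\<lambda>t. (v t)\<^sup>2 * (w t)\<^sup>2)"
  proof (intro integral_le cint_integrable continuous_intros cv)
    fix t assume t: "t \<in> {p..p+l}"
    have "(\<delta>/2)\<^sup>2 \<le> (v t)\<^sup>2" "(\<delta>/2)\<^sup>2 \<le> (w t)\<^sup>2"
      using p t l \<delta> by (auto intro!: power_mono low[OF v v' M(1)] low[OF w w' M(2)])
    then have "(\<delta>/2)\<^sup>2 * (\<delta>/2)\<^sup>2 \<le> (v t)\<^sup>2 * (w t)\<^sup>2" by (intro mult_mono) auto
    then show "(\<delta>/2)^4 \<le> (v t)\<^sup>2 * (w t)\<^sup>2" by (simp add: power_mult_distrib power_divide)
  qed
  also have "\<dots> \<le> cint (\<lambda>t. (v t)\<^sup>2 * (w t)\<^sup>2)"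
    unfolding cint_def using p l by (intro integral_subset_le cint_integrable continuous_intros cv) auto
  finally show ?thesis .
qed

text \<open>Truncating a normalised function at height \<open>2 \<delta>\<close> costs at most a fraction \<open>18 \<delta>\<close> of its
  squared norm, so \<open>poincare_superlevel\<close> applies to the truncation with almost no loss.\<close>

lemma length_eigenvalue_bound:
  fixes v v' :: "real \<Rightarrow> real"
  assumes v: "\<And>t. (v has_real_derivative v' t) (at t)" and v': "continuous_on UNIV v'"
    and per: "v (2*pi) = v 0"
    and nn: "\<And>t. 0 \<le> v t" and norm: "cint (\<lambda>t. (v t)\<^sup>2) = 1"
    and \<rho>: "continuous_on UNIV \<rho>" "\<And>t. 0 \<le> \<rho> t" "\<And>t. 2 * \<delta> < v t \<Longrightarrow> \<rho> t = 1"
    and t0: "t0 \<in> {0..2*pi}" "v t0 \<le> 2 * \<delta>"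
    and \<delta>: "0 < \<delta>" "18 * \<delta> < 1"
    and X: "0 \<le> X" "cint (\<lambda>t. (v' t)\<^sup>2) \<le> X\<^sup>2"
  shows "pi * (1 - 18 * \<delta>) \<le> cint \<rho> * X"
proof (rule ccontr)
  let ?y = "1 - 18 * \<delta>"
  define L where "L = cint \<rho>"
  define W where "W = cint (\<lambda>t. (max 0 (v t - 2*\<delta>))\<^sup>2)"
  assume "\<not> ?thesis"
  then have LX: "L * X < pi * ?y" by (simp add: L_def)
  have y: "0 < ?y" "?y \<le> 1" using \<delta> by auto
  have cv: "continuous_on UNIV v"
    by (rule continuous_on_if_deriv[OF v])
  have "cint (\<lambda>t. (v t)\<^sup>2 - 4*\<delta> * ((1 + (v t)\<^sup>2)/2)) \<le> W"
    unfolding W_def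
  proof (intro cint_mono continuous_intros cv)
    fix t
    have "0 \<le> (v t - 1)\<^sup>2" by simp
    then have "v t \<le> (1 + (v t)\<^sup>2)/2" by (simp add: power2_eq_square algebra_simps)
    then have "(v t)\<^sup>2 - 4*\<delta> * ((1 + (v t)\<^sup>2)/2) \<le> (v t)\<^sup>2 - 4*\<delta> * v t"
      using \<delta> by simp
    also have "\<dots> \<le> (max 0 (v t - 2*\<delta>))\<^sup>2"
    proof (cases "v t \<le> 2 * \<delta>")
      case True
      then have "v t * (v t - 4 * \<delta>) \<le> 0" using nn[of t] \<delta> by (intro mult_nonneg_nonpos) auto
      then show ?thesis using True by (simp add: power2_eq_square algebra_simps)
    next
      case False
      then show ?thesis by (simp add: power2_eq_square algebra_simps)
    qed
    finally show "(v t)\<^sup>2 - 4*\<delta> * ((1 + (v t)\<^sup>2)/2) \<le> (max 0 (v t - 2*\<delta>))\<^sup>2" .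
  qed auto
  moreover have "cint (\<lambda>t. (v t)\<^sup>2 - 4*\<delta> * ((1 + (v t)\<^sup>2)/2)) = 1 - 2*\<delta> * (2*pi + 1)"
  proof -
    have "cint (\<lambda>t. (v t)\<^sup>2 - 4*\<delta> * ((1 + (v t)\<^sup>2)/2)) = cint (\<lambda>t. (1 - 2*\<delta>) * (v t)\<^sup>2 - 2*\<delta>)"
      by (rule arg_cong[of _ _ cint]) (auto simp: algebra_simps)
    also have "\<dots> = (1 - 2*\<delta>) * cint (\<lambda>t. (v t)\<^sup>2) - cint (\<lambda>t. 2*\<delta>)"
      by (subst cint_diff) (auto intro!: continuous_intros cv simp: cint_cmult)
    finally show ?thesis by (simp add: norm cint_const algebra_simps)
  qed
  moreover have "2*\<delta> * (2*pi + 1) \<le> 2 * \<delta> * 9"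
    using \<delta> pi_less_4 by (intro mult_left_mono) auto
  ultimately have W: "?y \<le> W" by simp
  have L0: "0 \<le> L" unfolding L_def by (intro cint_nonneg \<rho>)
  \<comment> \<open>If the claim fails, \<open>a\<close> can be chosen slightly above \<open>X / y\<close> and still with \<open>a L < \<pi>\<close>.\<close>
  define Z where "Z = pi - L * X / ?y"
  define \<eta> where "\<eta> = Z / (2 * (L + 1))"
  define a where "a = X / ?y + \<eta>"
  have Z: "0 < Z" using LX y by (simp add: Z_def divide_less_eq mult.commute)
  then have \<eta>: "0 < \<eta>" using L0 by (simp add: \<eta>_def)
  have "L * \<eta> \<le> (L + 1) * \<eta>" using \<eta> by simp
  also have "\<dots> = Z / 2" using L0 by (simp add: \<eta>_def field_simps)
  also have "\<dots> < pi - L * X / ?y" using Z by (simp add: Z_def)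
  finally have "a * L < pi" unfolding a_def by (simp add: algebra_simps)
  moreover have "0 < a" using \<eta> X y by (simp add: a_def add_nonneg_pos)
  ultimately have "a\<^sup>2 * W \<le> cint (\<lambda>t. (v' t)\<^sup>2)"
    unfolding W_def L_def by (intro poincare_superlevel[OF v v' per \<rho> t0])
  then have "a\<^sup>2 * W \<le> X\<^sup>2" using X by simp
  have "X = (X / ?y) * ?y" using y by simp
  also have "\<dots> < a * ?y" using \<eta> y unfolding a_def by (intro mult_strict_right_mono) auto
  finally have "X\<^sup>2 < (a * ?y)\<^sup>2" using X by (intro power_strict_mono) auto
  also have "\<dots> = a\<^sup>2 * (?y * ?y)" by (simp add: power2_eq_square algebra_simps)
  also have "\<dots> \<le> a\<^sup>2 * (?y * 1)" using y by (intro mult_left_mono) auto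
  also have "\<dots> \<le> a\<^sup>2 * W" using W by (intro mult_left_mono) auto
  finally show False using \<open>a\<^sup>2 * W \<le> X\<^sup>2\<close> by simp
qed

text \<open>A family of functions with disjoint supports of lengths \<open>L\<^sub>i\<close> satisfies
  \<open>\<Sum> \<pi> / L\<^sub>i \<ge> m\<^sup>2 / 2\<close>, with equality for arcs of equal length. A strong interaction reduces the general case to this
  one: if some Rayleigh quotient is at least \<open>m\<^sup>4 / 4\<close>, it suffices alone; otherwise all of them are bounded, the overlap
  integrals are \<open>O(1/\<kappa>)\<close>, and by \<open>overlap_bound\<close> the sets where the functions exceed \<open>\<delta>\<close> are disjoint.\<close>

lemma optimal_partition_of_circle:
  fixes A :: "nat set" and e :: real
  assumes A: "finite A" "card A \<ge> 2" and e: "0 < e"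
  obtains \<kappa>0 where "\<And>\<kappa> v v'. \<kappa> \<ge> \<kappa>0 \<Longrightarrow>
     (\<And>i t. i \<in> A \<Longrightarrow> (v i has_real_derivative v' i t) (at t)) \<Longrightarrow>
     (\<And>i. i \<in> A \<Longrightarrow> continuous_on UNIV (v' i)) \<Longrightarrow>
     (\<And>i. i \<in> A \<Longrightarrow> v i (2*pi) = v i 0) \<Longrightarrow>
     (\<And>i t. i \<in> A \<Longrightarrow> 0 \<le> v i t) \<Longrightarrow>
     (\<And>i. i \<in> A \<Longrightarrow> cint (\<lambda>t. (v i t)\<^sup>2) = 1) \<Longrightarrow>
     (1 - e) * (real (card A))\<^sup>2 / 2 \<le>
       (\<Sum>i\<in>A. sqrt (cint (\<lambda>t. (v' i t)\<^sup>2 + \<kappa> * (v i t)\<^sup>2 * (\<Sum>j\<in>A - {i}. (v j t)\<^sup>2))))"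
proof -
  define m where "m = real (card A)"
  \<comment> \<open>\<open>18 \<delta> \<le> e\<close> is the loss allowed in \<open>length_eigenvalue_bound\<close>.\<close>
  define \<delta> where "\<delta> = min (e/18) (1/36)"
  define M where "M = m^4 / 4"
  define l where "l = min (\<delta>\<^sup>2 / (4 * M)) pi"
  define \<kappa>0 where "\<kappa>0 = 1 + M / (l * (\<delta>/2)^4)"
  have m: "2 \<le> m" using A by (simp add: m_def)
  have \<delta>: "0 < \<delta>" "18 * \<delta> < 1" "18 * \<delta> \<le> e" using e by (auto simp: \<delta>_def)
  have M: "0 < M" using m by (simp add: M_def)
  have l: "0 < l" "l \<le> \<delta>\<^sup>2 / (4 * M)" "l \<le> pi" using \<delta> M by (auto simp: l_def)
  have sqM: "sqrt M = m\<^sup>2/2" using m by (intro real_sqrt_unique) (auto simp: M_def power_divide)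
  show ?thesis
  proof (rule that[of \<kappa>0])
    fix \<kappa> :: real and v v' :: "nat \<Rightarrow> real \<Rightarrow> real"
    assume \<kappa>: "\<kappa> \<ge> \<kappa>0"
      and v: "\<And>i t. i \<in> A \<Longrightarrow> (v i has_real_derivative v' i t) (at t)"
      and v': "\<And>i. i \<in> A \<Longrightarrow> continuous_on UNIV (v' i)"
      and per: "\<And>i. i \<in> A \<Longrightarrow> v i (2*pi) = v i 0"
      and nn: "\<And>i t. i \<in> A \<Longrightarrow> 0 \<le> v i t"
      and norm: "\<And>i. i \<in> A \<Longrightarrow> cint (\<lambda>t. (v i t)\<^sup>2) = 1"
    let ?\<Lambda> = "\<lambda>i. cint (\<lambda>t. (v' i t)\<^sup>2 + \<kappa> * (v i t)\<^sup>2 * (\<Sum>j\<in>A - {i}. (v j t)\<^sup>2))"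
    have "0 < M / (l * (\<delta>/2)^4)" using l \<delta> M by simp
    then have \<kappa>_pos: "0 < \<kappa>" using \<kappa> unfolding \<kappa>0_def by linarith
    have cv: "continuous_on UNIV (v i)" if "i \<in> A" for i
      by (rule continuous_on_if_deriv[OF v[OF that]])
    note ci = continuous_intros cv v'
    have \<Lambda>0: "0 \<le> ?\<Lambda> i" if "i \<in> A" for i
      using that \<kappa>_pos by (intro cint_nonneg ci) (auto intro!: add_nonneg_nonneg mult_nonneg_nonneg sum_nonneg)
    show "(1 - e) * (real (card A))\<^sup>2 / 2 \<le> (\<Sum>i\<in>A. sqrt (?\<Lambda> i))"
    proof (cases "\<exists>i\<in>A. M \<le> ?\<Lambda> i")
      case True
      then obtain i where i: "i \<in> A" "M \<le> ?\<Lambda> i" by blast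
      have "(1 - e) * m\<^sup>2 \<le> 1 * m\<^sup>2" using e by (intro mult_right_mono) auto
      then have "(1 - e) * m\<^sup>2 / 2 \<le> sqrt M" by (simp add: sqM)
      also have "\<dots> \<le> sqrt (?\<Lambda> i)" using i by simp
      also have "\<dots> \<le> (\<Sum>i\<in>A. sqrt (?\<Lambda> i))"
        by (rule member_le_sum) (use i \<Lambda>0 A in auto)
      finally show ?thesis by (simp add: m_def)
    next
      case False
      have grad: "cint (\<lambda>t. (v' i t)\<^sup>2) \<le> ?\<Lambda> i" if "i \<in> A" for i
        using that \<kappa>_pos by (intro cint_mono ci) (auto intro!: mult_nonneg_nonneg sum_nonneg)
      have gradM: "cint (\<lambda>t. (v' i t)\<^sup>2) \<le> M" if "i \<in> A" for i
        using grad[OF that] False that by force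
      have disj: "v j t \<le> \<delta>" if "i \<in> A" "j \<in> A" "i \<noteq> j" "t \<in> {0..2*pi}" "\<delta> < v i t" for i j t
      proof (rule ccontr)
        assume "\<not> ?thesis"
        then have "l * (\<delta>/2)^4 \<le> cint (\<lambda>t. (v i t)\<^sup>2 * (v j t)\<^sup>2)"
          using that l by (intro overlap_bound[OF v v' v v' gradM gradM M \<delta>(1)]) auto
        moreover have "\<kappa> * cint (\<lambda>t. (v i t)\<^sup>2 * (v j t)\<^sup>2) \<le> ?\<Lambda> i"
          unfolding cint_cmult[symmetric]
        proof (intro cint_mono ci)
          fix t
          have "(v j t)\<^sup>2 \<le> (\<Sum>j\<in>A - {i}. (v j t)\<^sup>2)"
            by (rule member_le_sum) (use that A in auto)
          then have "\<kappa> * (v i t)\<^sup>2 * (v j t)\<^sup>2 \<le> \<kappa> * (v i t)\<^sup>2 * (\<Sum>j\<in>A - {i}. (v j t)\<^sup>2)"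
            using \<kappa>_pos by (intro mult_left_mono) auto
          then show "\<kappa> * ((v i t)\<^sup>2 * (v j t)\<^sup>2) \<le> (v' i t)\<^sup>2 + \<kappa> * (v i t)\<^sup>2 * (\<Sum>j\<in>A - {i}. (v j t)\<^sup>2)"
            by (simp add: mult.assoc add_increasing)
        qed (use that in auto)
        ultimately have "\<kappa> * (l * (\<delta>/2)^4) \<le> ?\<Lambda> i"
          using \<kappa>_pos by (meson less_eq_real_def mult_left_mono order_trans)
        also have "\<dots> < M" using False that by force
        finally have "\<kappa> < M / (l * (\<delta>/2)^4)"
          using l \<delta> by (simp add: pos_less_divide_eq)
        then show False using \<kappa> by (simp add: \<kappa>0_def)
      qed
      have large: "\<exists>t\<in>{0..2*pi}. 2 * \<delta> < v i t" if "i \<in> A" for i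
      proof (rule ccontr)
        assume "\<not> ?thesis"
        then have "v i t \<le> 1/16" if "t \<in> {0..2*pi}" for t
          using that by (force simp: \<delta>_def not_less)
        then have "cint (\<lambda>t. (v i t)\<^sup>2) \<le> cint (\<lambda>t. (1/16)\<^sup>2)"
          using nn[OF that] by (intro cint_mono ci power_mono that) auto
        then show False using norm[OF that] pi_less_4 by (simp add: cint_const power2_eq_square)
      qed
      \<comment> \<open>Continuous weights that are 1 where \<open>v\<^sub>i > 2 \<delta>\<close> and vanish where \<open>v\<^sub>i \<le> \<delta>\<close>; they are supported on disjoint sets.\<close>
      define \<rho> where "\<rho> i t = min 1 (max 0 ((v i t - \<delta>) / \<delta>))" for i t
      have \<rho>: "continuous_on UNIV (\<rho> i)" if "i \<in> A" for i
        unfolding \<rho>_def using that \<delta> by (intro ci) auto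
      have \<rho>0: "0 \<le> \<rho> i t" "\<rho> i t \<le> 1" for i t by (auto simp: \<rho>_def)
      have \<rho>1: "\<rho> i t = 1" if "2 * \<delta> < v i t" for i t
        using that \<delta> by (simp add: \<rho>_def field_simps)
      have sum1: "(\<Sum>i\<in>A. \<rho> i t) \<le> 1" if t: "t \<in> {0..2*pi}" for t
      proof (cases "\<exists>i\<in>A. \<delta> < v i t")
        case True
        then obtain i where i: "i \<in> A" "\<delta> < v i t" by blast
        have "\<rho> j t = 0" if "j \<in> A - {i}" for j
          using disj[of i j t] i t that \<delta> by (auto simp: \<rho>_def divide_le_0_iff)
        then have "(\<Sum>j\<in>A. \<rho> j t) = \<rho> i t"
          using i A by (subst sum.remove[of _ i]) auto
        then show ?thesis using \<rho>0 by simp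
      next
        case False
        then have "\<rho> j t = 0" if "j \<in> A" for j
          using that \<delta> by (auto simp: \<rho>_def divide_le_0_iff not_less)
        then show ?thesis by simp
      qed
      have "(\<Sum>i\<in>A. cint (\<rho> i)) = cint (\<lambda>t. \<Sum>i\<in>A. \<rho> i t)"
        by (rule cint_sum[symmetric]) (rule \<rho>)
      also have "\<dots> \<le> cint (\<lambda>t. 1)"
        using sum1 \<rho> by (intro cint_mono continuous_intros) auto
      finally have total: "(\<Sum>i\<in>A. cint (\<rho> i)) \<le> 2 * pi" by (simp add: cint_const)
      define y where "y = 1 - 18 * \<delta>"
      have y: "0 < y" "1 - e \<le> y" using \<delta> by (auto simp: y_def)
      have each: "y * (m - cint (\<rho> i) * m\<^sup>2 / (4 * pi)) \<le> sqrt (?\<Lambda> i)" if i: "i \<in> A" for i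
      proof -
        let ?L = "cint (\<rho> i)" and ?X = "sqrt (?\<Lambda> i)"
        have "A \<noteq> {i}" using A by auto
        then obtain j where j: "j \<in> A" "j \<noteq> i" using i by blast
        then obtain t0 where t0: "t0 \<in> {0..2*pi}" "2 * \<delta> < v j t0" using large by blast
        then have vt0: "v i t0 \<le> 2 * \<delta>" using disj[of j i t0] i j \<delta> by force
        have LX: "pi * y \<le> ?L * ?X"
          unfolding y_def
          by (rule length_eigenvalue_bound[OF v[OF i] v'[OF i] per[OF i] nn[OF i] norm[OF i] \<rho>[OF i] \<rho>0(1) \<rho>1 t0(1)])
             (use vt0 \<delta> \<Lambda>0[OF i] grad[OF i] in auto)
        have "0 \<le> ?L" by (intro cint_nonneg \<rho> i \<rho>0)
        moreover have "?L \<noteq> 0"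
          using LX mult_pos_pos[OF pi_gt_zero y(1)] by auto
        ultimately have L: "0 < ?L" by simp
        \<comment> \<open>The tangent line of the convex function \<open>\<pi> / L\<close> at the equal share \<open>L = 2 \<pi> / m\<close>.\<close>
        have "0 \<le> (?L * m - 2 * pi)\<^sup>2 / (4 * pi * ?L)" using L by simp
        also have "\<dots> = pi / ?L - (m - ?L * m\<^sup>2 / (4 * pi))"
          using L by (simp add: field_simps power2_eq_square)
        finally have "y * (m - ?L * m\<^sup>2 / (4 * pi)) \<le> y * (pi / ?L)"
          using y by (intro mult_left_mono) auto
        also have "\<dots> \<le> ?X" using LX L by (simp add: field_simps)
        finally show ?thesis .
      qed
      have "(1 - e) * m\<^sup>2 / 2 \<le> y * (m\<^sup>2 / 2)"
        using y mult_right_mono[of "1 - e" y "m\<^sup>2/2"] by simp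
      also have "m\<^sup>2 / 2 \<le> m\<^sup>2 - (\<Sum>i\<in>A. cint (\<rho> i)) * m\<^sup>2 / (4 * pi)"
      proof -
        have "(\<Sum>i\<in>A. cint (\<rho> i)) * (m\<^sup>2 / (4 * pi)) \<le> (2 * pi) * (m\<^sup>2 / (4 * pi))"
          using total by (intro mult_right_mono) auto
        then show ?thesis by simp
      qed
      also have "m\<^sup>2 - (\<Sum>i\<in>A. cint (\<rho> i)) * m\<^sup>2 / (4 * pi) = (\<Sum>i\<in>A. m - cint (\<rho> i) * m\<^sup>2 / (4 * pi))"
        by (simp add: sum_subtractf sum_distrib_right sum_divide_distrib m_def power2_eq_square)
      also have "y * \<dots> = (\<Sum>i\<in>A. y * (m - cint (\<rho> i) * m\<^sup>2 / (4 * pi)))"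
        by (rule sum_distrib_left)
      also have "\<dots> \<le> (\<Sum>i\<in>A. sqrt (?\<Lambda> i))" by (rule sum_mono) (rule each)
      finally show ?thesis using y by (simp add: m_def mult_left_mono)
    qed
  qed
qed

section \<open>Integrals and derivatives with a parameter\<close>

lemma cint_deriv:
  fixes F F' :: "real \<Rightarrow> real \<Rightarrow> real"
  assumes F: "\<And>s t. ((\<lambda>r. F r t) has_real_derivative F' s t) (at s)"
    and c: "\<And>s. continuous_on UNIV (F s)" and c': "continuous_on UNIV (\<lambda>p. F' (fst p) (snd p))"
  shows "((\<lambda>r. cint (F r)) has_real_derivative cint (F' r)) (at r)"
proof -
  have "((\<lambda>r. integral (cbox 0 (2*pi)) (F r)) has_real_derivative integral (cbox 0 (2*pi)) (F' r)) (at r within UNIV)"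
    by (rule leibniz_rule_field_derivative)
       (use F c in \<open>auto intro!: cint_integrable continuous_on_subset[OF c'] simp: split_beta\<close>)
  then show ?thesis by (simp add: cint_def[abs_def])
qed

lemma cint_by_parts_zero:
  fixes G :: "real \<Rightarrow> real"
  assumes "\<And>t. (G has_real_derivative G' t) (at t)" "G (2*pi) = G 0"
  shows "cint G' = 0"
proof -
  have "(G' has_integral G (2*pi) - G 0) {0..2*pi}"
    by (rule fundamental_theorem_of_calculus)
       (use assms in \<open>auto simp: has_real_derivative_iff_has_vector_derivative[symmetric] intro: has_field_derivative_at_within\<close>)
  then show ?thesis using assms by (simp add: cint_def integral_unique)
qed

lemma cint_eq_0D:
  assumes "continuous_on UNIV f" "\<And>t. 0 \<le> f t" "cint f = 0" "t \<in> {0..2*pi}"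
  shows "f t = 0"
proof -
  have "(f has_integral 0) (cbox 0 (2*pi))"
    using cint_integrable[OF assms(1), of 0 "2*pi"] assms(3) unfolding cint_def
    by (simp add: has_integral_iff)
  then show ?thesis
    by (rule has_integral_0_cbox_imp_0[rotated 2]) (use assms pi_gt_zero in \<open>auto intro: continuous_on_subset simp del: pi_gt_zero\<close>)
qed

text \<open>Symmetry of the mixed second derivatives, by differentiating the fundamental theorem of calculus in \<open>t\<close>
  with respect to \<open>r\<close>.\<close>

lemma mixed_derivative:
  fixes g gr gt gtr :: "real \<Rightarrow> real \<Rightarrow> real"
  assumes "\<And>r t. ((\<lambda>r. g r t) has_real_derivative gr r t) (at r)"
    and "\<And>r t. (g r has_real_derivative gt r t) (at t)"
    and "\<And>r t. ((\<lambda>r. gt r t) has_real_derivative gtr r t) (at r)"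
    and cont: "continuous_on UNIV (\<lambda>p. gt (fst p) (snd p))" "continuous_on UNIV (\<lambda>p. gtr (fst p) (snd p))"
  shows "(gr r has_real_derivative gtr r t) (at t)"
proof -
  define a where "a = t - 1"
  have gtc: "continuous_on UNIV (gt s)" for s
    using continuous_on_compose2[OF cont(1) continuous_on_Pair[OF continuous_on_const continuous_on_id]] by simp
  have gtrc: "continuous_on UNIV (gtr s)" for s
    using continuous_on_compose2[OF cont(2) continuous_on_Pair[OF continuous_on_const continuous_on_id]] by simp
  have eq: "gr r x = gr r a + integral {a..x} (gtr r)" if x: "a \<le> x" for x
  proof -
    have "((\<lambda>s. integral (cbox a x) (gt s)) has_real_derivative integral (cbox a x) (gtr r)) (at r within UNIV)"
      by (rule leibniz_rule_field_derivative)
         (use assms gtc in \<open>auto intro!: cint_integrable continuous_on_subset[OF cont(2)] simp: split_beta\<close>)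
    moreover have "integral (cbox a x) (gt s) = g s x - g s a" for s
    proof -
      have "(gt s has_integral g s x - g s a) {a..x}"
        by (rule fundamental_theorem_of_calculus[OF x])
           (use assms in \<open>auto simp: has_real_derivative_iff_has_vector_derivative[symmetric] intro: has_field_derivative_at_within\<close>)
      then show ?thesis by (simp add: integral_unique)
    qed
    ultimately have "((\<lambda>s. g s x - g s a) has_real_derivative integral {a..x} (gtr r)) (at r)"
      by simp
    moreover have "((\<lambda>s. g s x - g s a) has_real_derivative gr r x - gr r a) (at r)"
      by (intro DERIV_diff assms)
    ultimately have "integral {a..x} (gtr r) = gr r x - gr r a"
      by (rule DERIV_unique)
    then show ?thesis by simp
  qed
  have "((\<lambda>x. integral {a..x} (gtr r)) has_real_derivative gtr r t) (at t within {a..t+1})"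
    by (rule integral_has_real_derivative) (use gtrc in \<open>auto simp: a_def intro: continuous_on_subset\<close>)
  then have "((\<lambda>x. integral {a..x} (gtr r)) has_real_derivative gtr r t) (at t)"
    by (subst (asm) at_within_interior) (auto simp: a_def)
  then have "((\<lambda>x. gr r a + integral {a..x} (gtr r)) has_real_derivative gtr r t) (at t)"
    by (auto intro!: derivative_eq_intros)
  then show ?thesis
  proof (rule has_field_derivative_transform_within_open)
    show "open {a<..}" "t \<in> {a<..}" by (auto simp: a_def)
    show "gr r a + integral {a..x} (gtr r) = gr r x" if "x \<in> {a<..}" for x
      using that by (intro eq[symmetric]) auto
  qed
qed

lemma nondecreasing_from:
  fixes f f' :: "real \<Rightarrow> real"
  assumes "a \<le> b" "continuous_on UNIV f" "\<And>x. a < x \<Longrightarrow> (f has_real_derivative f' x) (at x)"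
    "\<And>x. a < x \<Longrightarrow> 0 \<le> f' x"
  shows "f a \<le> f b"
proof (rule DERIV_nonneg_imp_increasing_open[OF assms(1)])
  show "\<exists>y. (f has_real_derivative y) (at x) \<and> 0 \<le> y" if "a < x" for x
    using assms(3,4)[OF that] by blast
  show "continuous_on {a..b} f" by (rule continuous_on_subset[OF assms(2)]) simp
qed

section \<open>The system in polar coordinates\<close>

text \<open>The functions \<open>g i r t\<close> stand for \<open>u\<^sub>i\<close> at the point with polar coordinates \<open>(r, t)\<close>, and the other
  families for its partial derivatives. The radius ranges over all reals, which makes everything smooth across \<open>r = 0\<close>.
  The assumption \<open>equation\<close> is the system multiplied by \<open>r\<^sup>2\<close>.\<close>

locale polar_system =
  fixes k :: nat and g gr gt grr gtr gtt :: "nat \<Rightarrow> real \<Rightarrow> real \<Rightarrow> real"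
  assumes g_r: "i \<in> {1..k} \<Longrightarrow> ((\<lambda>r. g i r t) has_real_derivative gr i r t) (at r)"
    and g_t: "i \<in> {1..k} \<Longrightarrow> (g i r has_real_derivative gt i r t) (at t)"
    and gr_r: "i \<in> {1..k} \<Longrightarrow> ((\<lambda>r. gr i r t) has_real_derivative grr i r t) (at r)"
    and gt_r: "i \<in> {1..k} \<Longrightarrow> ((\<lambda>r. gt i r t) has_real_derivative gtr i r t) (at r)"
    and gt_t: "i \<in> {1..k} \<Longrightarrow> (gt i r has_real_derivative gtt i r t) (at t)"
    and cont_uncurried: "i \<in> {1..k} \<Longrightarrow> continuous_on UNIV (\<lambda>p. g i (fst p) (snd p))"
      "i \<in> {1..k} \<Longrightarrow> continuous_on UNIV (\<lambda>p. gr i (fst p) (snd p))"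
      "i \<in> {1..k} \<Longrightarrow> continuous_on UNIV (\<lambda>p. gt i (fst p) (snd p))"
      "i \<in> {1..k} \<Longrightarrow> continuous_on UNIV (\<lambda>p. grr i (fst p) (snd p))"
      "i \<in> {1..k} \<Longrightarrow> continuous_on UNIV (\<lambda>p. gtr i (fst p) (snd p))"
      "i \<in> {1..k} \<Longrightarrow> continuous_on UNIV (\<lambda>p. gtt i (fst p) (snd p))"
    and periodic: "i \<in> {1..k} \<Longrightarrow> g i r (2*pi) = g i r 0" "i \<in> {1..k} \<Longrightarrow> gr i r (2*pi) = gr i r 0"
      "i \<in> {1..k} \<Longrightarrow> gt i r (2*pi) = gt i r 0"
    and gt_centre: "i \<in> {1..k} \<Longrightarrow> gt i 0 t = 0"
    and equation: "i \<in> {1..k} \<Longrightarrow>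
      r\<^sup>2 * grr i r t + r * gr i r t + gtt i r t = r\<^sup>2 * (g i r t * (\<Sum>j\<in>{1..k} - {i}. (g j r t)\<^sup>2))"
begin

text \<open>Here \<open>Q i\<close> is the potential felt by component \<open>i\<close>, and \<open>P\<close> is the interaction energy density; subtracting the
  diagonal term makes it a polynomial in two symmetric sums, which is easier to differentiate than a sum over pairs.\<close>

definition Q :: "nat \<Rightarrow> real \<Rightarrow> real \<Rightarrow> real" where
  "Q i r t = (\<Sum>j\<in>{1..k}. (g j r t)\<^sup>2) - (g i r t)\<^sup>2"

definition P :: "real \<Rightarrow> real \<Rightarrow> real" where
  "P r t = (\<Sum>i\<in>{1..k}. (g i r t)\<^sup>2 * Q i r t) / 2"

text \<open>The quantities below are defined as integrals over a single circle. For \<open>J\<close> and \<open>K\<close> this anticipates the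
  divergence theorem and the Pohozaev identity: their derivatives show that \<open>J i\<close> is the energy of component \<open>i\<close> in the
  disc (lemma \<open>J_deriv\<close>), and that \<open>K\<close> is the integral of \<open>P\<close> over the disc (lemma \<open>K_deriv\<close>). Accordingly \<open>EE\<close> is the
  energy \<open>E\<close>, in which every pair counts once, whereas the sum of the \<open>J i\<close> counts it twice.\<close>

definition hh :: "nat \<Rightarrow> real \<Rightarrow> real" where "hh i r = cint (\<lambda>t. (g i r t)\<^sup>2)"

definition J :: "nat \<Rightarrow> real \<Rightarrow> real" where "J i r = r * cint (\<lambda>t. g i r t * gr i r t)"

definition J' :: "nat \<Rightarrow> real \<Rightarrow> real" where
  "J' i r = cint (\<lambda>t. r * (gr i r t)\<^sup>2 + (gt i r t)\<^sup>2 / r + r * ((g i r t)\<^sup>2 * Q i r t))"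

definition K :: "real \<Rightarrow> real" where
  "K r = ((\<Sum>i\<in>{1..k}. cint (\<lambda>t. (gt i r t)\<^sup>2 - r\<^sup>2 * (gr i r t)\<^sup>2)) + r\<^sup>2 * cint (P r)) / 2"

definition HH :: "real \<Rightarrow> real" where "HH r = (\<Sum>i\<in>{1..k}. hh i r)"

definition EE :: "real \<Rightarrow> real" where "EE r = (\<Sum>i\<in>{1..k}. J i r) - K r"

lemma Q_eq: "i \<in> {1..k} \<Longrightarrow> Q i r t = (\<Sum>j\<in>{1..k} - {i}. (g j r t)\<^sup>2)"
  by (simp add: Q_def sum_diff1)

lemma Q_nonneg: "i \<in> {1..k} \<Longrightarrow> 0 \<le> Q i r t"
  by (simp add: Q_eq sum_nonneg)

lemma P_nonneg: "0 \<le> P r t"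
  unfolding P_def by (intro divide_nonneg_nonneg sum_nonneg mult_nonneg_nonneg Q_nonneg) auto

lemma single_le_P:
  assumes i: "i \<in> {1..k}" shows "(g i r t)\<^sup>2 * Q i r t \<le> P r t"
proof -
  have "(\<Sum>j\<in>{1..k} - {i}. (g j r t)\<^sup>2 * (g i r t)\<^sup>2) \<le> (\<Sum>j\<in>{1..k} - {i}. (g j r t)\<^sup>2 * Q j r t)"
  proof (intro sum_mono mult_left_mono)
    fix j assume j: "j \<in> {1..k} - {i}"
    then show "(g i r t)\<^sup>2 \<le> Q j r t"
      using i by (subst Q_eq) (auto intro!: member_le_sum)
  qed auto
  moreover have "(\<Sum>j\<in>{1..k} - {i}. (g j r t)\<^sup>2 * (g i r t)\<^sup>2) = (g i r t)\<^sup>2 * Q i r t"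
    using i by (simp add: Q_eq sum_distrib_left mult.commute)
  ultimately have "2 * ((g i r t)\<^sup>2 * Q i r t) \<le> (g i r t)\<^sup>2 * Q i r t + (\<Sum>j\<in>{1..k} - {i}. (g j r t)\<^sup>2 * Q j r t)"
    by linarith
  also have "\<dots> = 2 * P r t"
    using i sum.remove[of "{1..k}" i "\<lambda>i. (g i r t)\<^sup>2 * Q i r t"] by (simp add: P_def)
  finally show ?thesis by simp
qed

lemma cont [continuous_intros]:
  fixes S :: "'z::topological_space set"
  assumes i: "i \<in> {1..k}" and ab: "continuous_on S a" "continuous_on S b"
  shows "continuous_on S (\<lambda>x. g i (a x) (b x))" "continuous_on S (\<lambda>x. gr i (a x) (b x))"
    "continuous_on S (\<lambda>x. gt i (a x) (b x))" "continuous_on S (\<lambda>x. grr i (a x) (b x))"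
    "continuous_on S (\<lambda>x. gtr i (a x) (b x))" "continuous_on S (\<lambda>x. gtt i (a x) (b x))"
  using cont_uncurried[OF i, THEN continuous_on_compose2, OF continuous_on_Pair[OF ab]] by simp_all

lemma cont_curried [continuous_intros]:
  assumes i: "i \<in> {1..k}"
  shows "continuous_on S (g i r)" "continuous_on S (gr i r)" "continuous_on S (gt i r)"
  using cont[OF i, of S "\<lambda>_. r" "\<lambda>t. t"] by simp_all

lemma cont_Q [continuous_intros]:
  fixes S :: "'z::topological_space set"
  assumes "i \<in> {1..k}" "continuous_on S a" "continuous_on S b"
  shows "continuous_on S (\<lambda>x. Q i (a x) (b x))"
  unfolding Q_def by (intro continuous_intros assms) auto

lemma cont_P [continuous_intros]:
  fixes S :: "'z::topological_space set"
  assumes "continuous_on S a" "continuous_on S b"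
  shows "continuous_on S (\<lambda>x. P (a x) (b x))"
  unfolding P_def by (intro continuous_intros assms) auto

lemma gr_t: "i \<in> {1..k} \<Longrightarrow> (gr i r has_real_derivative gtr i r t) (at t)"
  by (rule mixed_derivative[OF g_r g_t gt_r cont_uncurried(3) cont_uncurried(5)])

lemma hh_deriv_raw:
  assumes i: "i \<in> {1..k}"
  shows "(hh i has_real_derivative 2 * cint (\<lambda>t. g i r t * gr i r t)) (at r)"
proof -
  have "((\<lambda>r. cint (\<lambda>t. (g i r t)\<^sup>2)) has_real_derivative cint (\<lambda>t. 2 * (g i r t * gr i r t))) (at r)"
    by (rule cint_deriv) (auto intro!: derivative_eq_intros continuous_intros g_r[OF i] i)
  then show ?thesis unfolding hh_def[abs_def] by (simp add: cint_cmult)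
qed

lemma hh_deriv:
  assumes "i \<in> {1..k}" "0 < r"
  shows "(hh i has_real_derivative 2 * J i r / r) (at r)"
  using hh_deriv_raw[OF assms(1), of r] assms(2) by (simp add: J_def)

lemma J_deriv_raw:
  assumes i: "i \<in> {1..k}"
  shows "(J i has_real_derivative cint (\<lambda>t. g i r t * gr i r t + r * ((gr i r t)\<^sup>2 + g i r t * grr i r t))) (at r)"
proof -
  have "((\<lambda>r. cint (\<lambda>t. g i r t * gr i r t)) has_real_derivative
      cint (\<lambda>t. (gr i r t)\<^sup>2 + g i r t * grr i r t)) (at r)"
    by (rule cint_deriv)
       (auto intro!: derivative_eq_intros continuous_intros g_r[OF i] gr_r[OF i] i simp: power2_eq_square)
  then have "(J i has_real_derivative cint (\<lambda>t. g i r t * gr i r t) + r * cint (\<lambda>t. (gr i r t)\<^sup>2 + g i r t * grr i r t)) (at r)"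
    unfolding J_def[abs_def] by (auto intro!: derivative_eq_intros)
  moreover have "cint (\<lambda>t. g i r t * gr i r t) + r * cint (\<lambda>t. (gr i r t)\<^sup>2 + g i r t * grr i r t)
     = cint (\<lambda>t. g i r t * gr i r t + r * ((gr i r t)\<^sup>2 + g i r t * grr i r t))"
    by (subst cint_add) (auto intro!: continuous_intros i simp: cint_cmult)
  ultimately show ?thesis by simp
qed

text \<open>Green's identity: the angular part of the Laplacian is integrated by parts over the period.\<close>

lemma J_deriv:
  assumes i: "i \<in> {1..k}" and r: "0 < r"
  shows "(J i has_real_derivative J' i r) (at r)"
proof -
  have "cint (\<lambda>t. g i r t * gr i r t + r * ((gr i r t)\<^sup>2 + g i r t * grr i r t)) = J' i r"
  proof -
    have "cint (\<lambda>t. (gt i r t)\<^sup>2 + g i r t * gtt i r t) = 0"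
      by (rule cint_by_parts_zero[of "\<lambda>t. g i r t * gt i r t"])
         (auto intro!: derivative_eq_intros g_t[OF i] gt_t[OF i] simp: power2_eq_square periodic[OF i])
    then have "J' i r = J' i r - cint (\<lambda>t. 1/r * ((gt i r t)\<^sup>2 + g i r t * gtt i r t))"
      by (simp only: cint_cmult)
    also have "\<dots> = cint (\<lambda>t. (r * (gr i r t)\<^sup>2 + (gt i r t)\<^sup>2 / r + r * ((g i r t)\<^sup>2 * Q i r t))
        - 1/r * ((gt i r t)\<^sup>2 + g i r t * gtt i r t))"
      unfolding J'_def using r by (intro cint_diff[symmetric] continuous_intros i) auto
    also have "\<dots> = cint (\<lambda>t. g i r t * gr i r t + r * ((gr i r t)\<^sup>2 + g i r t * grr i r t))"
    proof (rule arg_cong[of _ _ cint], rule ext)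
      fix t
      have gtt: "gtt i r t = r\<^sup>2 * (g i r t * Q i r t) - r\<^sup>2 * grr i r t - r * gr i r t"
        using equation[OF i, of r t] by (simp add: Q_eq[OF i])
      show "(r * (gr i r t)\<^sup>2 + (gt i r t)\<^sup>2 / r + r * ((g i r t)\<^sup>2 * Q i r t))
        - 1/r * ((gt i r t)\<^sup>2 + g i r t * gtt i r t) =
        g i r t * gr i r t + r * ((gr i r t)\<^sup>2 + g i r t * grr i r t)"
        unfolding gtt using r by (simp add: field_simps power2_eq_square)
    qed
    finally show ?thesis by simp
  qed
  then show ?thesis using J_deriv_raw[OF i, of r] by simp
qed

lemma P_deriv: "((\<lambda>r. P r t) has_real_derivative (\<Sum>i\<in>{1..k}. 2 * g i r t * gr i r t * Q i r t)) (at r)"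
proof -
  let ?S = "\<lambda>r. \<Sum>j\<in>{1..k}. (g j r t)\<^sup>2" and ?S' = "\<Sum>j\<in>{1..k}. 2 * g j r t * gr j r t"
  have S: "(?S has_real_derivative ?S') (at r)"
    by (rule DERIV_sum) (auto intro!: derivative_eq_intros g_r)
  have "((\<lambda>r. (?S r * ?S r - (\<Sum>i\<in>{1..k}. (g i r t)^4)) / 2) has_real_derivative
      (?S' * ?S r + ?S' * ?S r - (\<Sum>i\<in>{1..k}. 4 * (g i r t)^3 * gr i r t)) / 2) (at r)"
    by (intro DERIV_cdivide DERIV_diff DERIV_mult S DERIV_sum) (auto intro!: derivative_eq_intros g_r)
  moreover have "(\<lambda>r. (?S r * ?S r - (\<Sum>i\<in>{1..k}. (g i r t)^4)) / 2) = (\<lambda>r. P r t)"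
    by (rule ext) (simp add: P_def Q_def right_diff_distrib sum_subtractf sum_distrib_right flip: power_add)
  ultimately have D: "((\<lambda>r. P r t) has_real_derivative
      (?S' * ?S r + ?S' * ?S r - (\<Sum>i\<in>{1..k}. 4 * (g i r t)^3 * gr i r t)) / 2) (at r)"
    by (simp only:)
  have "(?S' * ?S r + ?S' * ?S r - (\<Sum>i\<in>{1..k}. 4 * (g i r t)^3 * gr i r t)) / 2
     = ?S' * ?S r - (\<Sum>i\<in>{1..k}. 2 * g i r t * gr i r t * (g i r t)\<^sup>2)"
  proof -
    have "(\<Sum>i\<in>{1..k}. 4 * (g i r t)^3 * gr i r t) = 2 * (\<Sum>i\<in>{1..k}. 2 * g i r t * gr i r t * (g i r t)\<^sup>2)"
      unfolding sum_distrib_left by (intro sum.cong) (auto simp: power2_eq_square power3_eq_cube)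
    then show ?thesis by simp
  qed
  also have "\<dots> = (\<Sum>i\<in>{1..k}. 2 * g i r t * gr i r t * Q i r t)"
    by (simp add: Q_def right_diff_distrib sum_subtractf sum_distrib_right)
  finally show ?thesis using D by (simp only:)
qed

text \<open>The Pohozaev identity in differential form. Multiplying the equation by \<open>r\<^sup>2 \<partial>\<^sub>r u\<^sub>i\<close> turns the second derivatives
  into a total derivative and the right-hand side into \<open>r\<^sup>2 \<partial>\<^sub>r P / 2\<close> after summation over \<open>i\<close>.\<close>

lemma K_deriv: "(K has_real_derivative r * cint (P r)) (at r)"
proof -
  have 1: "((\<lambda>r. cint (\<lambda>t. (gt i r t)\<^sup>2 - r\<^sup>2 * (gr i r t)\<^sup>2)) has_real_derivative
     cint (\<lambda>t. - 2 * r\<^sup>2 * (g i r t * gr i r t * Q i r t))) (at r)" if i: "i \<in> {1..k}" for i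
  proof -
    have "((\<lambda>r. cint (\<lambda>t. (gt i r t)\<^sup>2 - r\<^sup>2 * (gr i r t)\<^sup>2)) has_real_derivative
       cint (\<lambda>t. 2 * gt i r t * gtr i r t - (2 * r * (gr i r t)\<^sup>2 + r\<^sup>2 * (2 * gr i r t * grr i r t)))) (at r)"
      by (rule cint_deriv)
         (auto intro!: derivative_eq_intros continuous_intros gt_r[OF i] gr_r[OF i] i)
    also have "cint (\<lambda>t. 2 * gt i r t * gtr i r t - (2 * r * (gr i r t)\<^sup>2 + r\<^sup>2 * (2 * gr i r t * grr i r t)))
      = cint (\<lambda>t. 2 * gt i r t * gtr i r t - (2 * r * (gr i r t)\<^sup>2 + r\<^sup>2 * (2 * gr i r t * grr i r t)))
        - cint (\<lambda>t. 2 * (gtt i r t * gr i r t + gt i r t * gtr i r t))"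
    proof -
      have "cint (\<lambda>t. 2 * (gtt i r t * gr i r t + gt i r t * gtr i r t)) = 0"
        by (rule cint_by_parts_zero[of "\<lambda>t. 2 * (gt i r t * gr i r t)"])
           (auto intro!: derivative_eq_intros gt_t[OF i] gr_t[OF i] simp: periodic[OF i])
      then show ?thesis by simp
    qed
    also have "\<dots> = cint (\<lambda>t. (2 * gt i r t * gtr i r t - (2 * r * (gr i r t)\<^sup>2 + r\<^sup>2 * (2 * gr i r t * grr i r t)))
        - 2 * (gtt i r t * gr i r t + gt i r t * gtr i r t))"
      by (rule cint_diff[symmetric]) (intro continuous_intros i)+
    also have "\<dots> = cint (\<lambda>t. - 2 * r\<^sup>2 * (g i r t * gr i r t * Q i r t))"
    proof (rule arg_cong[of _ _ cint], rule ext)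
      fix t
      have "gtt i r t = r\<^sup>2 * (g i r t * Q i r t) - r\<^sup>2 * grr i r t - r * gr i r t"
        using equation[OF i, of r t] by (simp add: Q_eq[OF i])
      then show "(2 * gt i r t * gtr i r t - (2 * r * (gr i r t)\<^sup>2 + r\<^sup>2 * (2 * gr i r t * grr i r t)))
        - 2 * (gtt i r t * gr i r t + gt i r t * gtr i r t) = - 2 * r\<^sup>2 * (g i r t * gr i r t * Q i r t)"
        by algebra
    qed
    finally show ?thesis .
  qed
  have 2: "((\<lambda>r. cint (P r)) has_real_derivative cint (\<lambda>t. \<Sum>i\<in>{1..k}. 2 * g i r t * gr i r t * Q i r t)) (at r)"
    by (rule cint_deriv[OF P_deriv]) (intro continuous_intros | simp)+
  have "(K has_real_derivative ((\<Sum>i\<in>{1..k}. cint (\<lambda>t. - 2 * r\<^sup>2 * (g i r t * gr i r t * Q i r t)))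
     + (2 * r * cint (P r) + r\<^sup>2 * cint (\<lambda>t. \<Sum>i\<in>{1..k}. 2 * g i r t * gr i r t * Q i r t))) / 2) (at r)"
    unfolding K_def[abs_def]
    by (intro DERIV_cdivide DERIV_add DERIV_sum 1) (auto intro!: derivative_eq_intros 2)
  moreover have "r\<^sup>2 * cint (\<lambda>t. \<Sum>i\<in>{1..k}. 2 * g i r t * gr i r t * Q i r t)
     = - (\<Sum>i\<in>{1..k}. cint (\<lambda>t. - 2 * r\<^sup>2 * (g i r t * gr i r t * Q i r t)))"
  proof -
    have "cint (\<lambda>t. 2 * g i r t * gr i r t * Q i r t) = 2 * cint (\<lambda>t. g i r t * gr i r t * Q i r t)" for i
      by (subst cint_cmult[symmetric]) (simp add: mult.assoc)
    moreover have "cint (\<lambda>t. - 2 * r\<^sup>2 * (g i r t * gr i r t * Q i r t)) = - 2 * r\<^sup>2 * cint (\<lambda>t. g i r t * gr i r t * Q i r t)" for i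
      by (rule cint_cmult)
    moreover have "cint (\<lambda>t. \<Sum>i\<in>{1..k}. 2 * g i r t * gr i r t * Q i r t) = (\<Sum>i\<in>{1..k}. cint (\<lambda>t. 2 * g i r t * gr i r t * Q i r t))"
      by (rule cint_sum) (intro continuous_intros)
    ultimately show ?thesis
      by (simp only: sum_distrib_left sum_negf[symmetric]) (rule sum.cong, simp_all)
  qed
  ultimately show ?thesis by simp
qed

lemma continuous_profiles:
  "i \<in> {1..k} \<Longrightarrow> continuous_on UNIV (hh i)" "i \<in> {1..k} \<Longrightarrow> continuous_on UNIV (J i)"
  "continuous_on UNIV K"
  by (rule continuous_on_if_deriv[OF hh_deriv_raw] continuous_on_if_deriv[OF J_deriv_raw]
      continuous_on_if_deriv[OF K_deriv]; assumption)+

lemma continuous_EE: "continuous_on UNIV EE"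
  unfolding EE_def by (intro continuous_intros continuous_profiles)

lemma J'_nonneg:
  assumes "i \<in> {1..k}" "0 < r" shows "0 \<le> J' i r"
  unfolding J'_def using assms Q_nonneg
  by (intro cint_nonneg continuous_intros) (auto intro!: add_nonneg_nonneg mult_nonneg_nonneg)

lemma J_mono:
  assumes "i \<in> {1..k}" "0 \<le> a" "a \<le> b" shows "J i a \<le> J i b"
  by (rule nondecreasing_from[OF assms(3) continuous_profiles(2) J_deriv J'_nonneg])
     (use assms in auto)

lemma J_nonneg: "i \<in> {1..k} \<Longrightarrow> 0 \<le> r \<Longrightarrow> 0 \<le> J i r"
  using J_mono[of i 0 r] by (simp add: J_def)

lemma hh_mono:
  assumes "i \<in> {1..k}" "0 \<le> a" "a \<le> b" shows "hh i a \<le> hh i b"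
  by (rule nondecreasing_from[OF assms(3) continuous_profiles(1) hh_deriv])
     (use assms J_nonneg in auto)

lemma hh_nonneg: "i \<in> {1..k} \<Longrightarrow> 0 \<le> hh i r"
  unfolding hh_def by (intro cint_nonneg continuous_intros) auto

lemma hh_pos:
  assumes "i \<in> {1..k}" "t \<in> {0..2*pi}" "g i r t \<noteq> 0" shows "0 < hh i r"
proof (rule ccontr)
  assume "\<not> ?thesis"
  then have "cint (\<lambda>t. (g i r t)\<^sup>2) = 0" using hh_nonneg[OF assms(1), of r] by (simp add: hh_def)
  then have "(g i r t)\<^sup>2 = 0"
    by (rule cint_eq_0D[rotated 2, OF _ assms(2)]) (auto intro!: continuous_intros assms(1))
  then show False using assms by simp
qed

lemma K_nonneg:
  assumes "0 \<le> r" shows "0 \<le> K r"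
proof -
  have "K 0 \<le> K r"
  proof (rule nondecreasing_from[OF assms continuous_profiles(3) K_deriv])
    show "0 \<le> x * cint (P x)" if "0 < x" for x
      using that P_nonneg by (intro mult_nonneg_nonneg cint_nonneg continuous_intros cont_P[of _ "\<lambda>_. x" "\<lambda>t. t"]) auto
  qed
  moreover have "K 0 = 0"
    by (simp add: K_def gt_centre cint_const)
  ultimately show ?thesis by simp
qed

definition EE' :: "real \<Rightarrow> real" where
  "EE' r = cint (\<lambda>t. (\<Sum>i\<in>{1..k}. r * (gr i r t)\<^sup>2 + (gt i r t)\<^sup>2 / r) + r * P r t)"

lemma cont_P_curried: "continuous_on S (P r)"
  using cont_P[of S "\<lambda>_. r" "\<lambda>t. t"] by (simp add: continuous_intros)

lemma EE_deriv:
  assumes r: "0 < r" shows "(EE has_real_derivative EE' r) (at r)"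
proof -
  have "(EE has_real_derivative (\<Sum>i\<in>{1..k}. J' i r) - r * cint (P r)) (at r)"
    unfolding EE_def[abs_def] by (intro DERIV_diff DERIV_sum J_deriv K_deriv r)
  also have "(\<Sum>i\<in>{1..k}. J' i r) - r * cint (P r)
     = cint (\<lambda>t. (\<Sum>i\<in>{1..k}. r * (gr i r t)\<^sup>2 + (gt i r t)\<^sup>2 / r + r * ((g i r t)\<^sup>2 * Q i r t)) - r * P r t)"
    unfolding J'_def using r
    by (subst cint_diff cint_sum | subst cint_cmult | intro continuous_intros cont_P_curried | simp)+
  also have "\<dots> = EE' r"
    unfolding EE'_def
    by (intro arg_cong[of _ _ cint] ext)
       (simp add: sum.distrib P_def flip: sum_distrib_left)
  finally show ?thesis .
qed

section \<open>Almgren's formula and the upper growth bound\<close>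

text \<open>Both sides vanish at 0, and the derivatives are ordered because \<open>u\<^sub>i\<^sup>2 Q\<^sub>i\<close> collects only some of the pairs in \<open>P\<close>.\<close>

lemma J_le_EE:
  assumes i: "i \<in> {1..k}" and r: "0 \<le> r" shows "J i r \<le> EE r"
proof -
  have "EE 0 - J i 0 \<le> EE r - J i r"
  proof (rule nondecreasing_from[OF r])
    show "continuous_on UNIV (\<lambda>r. EE r - J i r)"
      by (intro continuous_intros continuous_EE continuous_profiles i)
    show "((\<lambda>r. EE r - J i r) has_real_derivative EE' x - J' i x) (at x)" if "0 < x" for x
      by (intro DERIV_diff EE_deriv J_deriv i that)
    show "0 \<le> EE' x - J' i x" if x: "0 < x" for x
    proof -
      have "J' i x \<le> EE' x"
        unfolding J'_def EE'_def
      proof (intro cint_mono continuous_intros cont_P_curried i)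
        fix t
        have "x * (gr i x t)\<^sup>2 + (gt i x t)\<^sup>2 / x \<le> (\<Sum>i\<in>{1..k}. x * (gr i x t)\<^sup>2 + (gt i x t)\<^sup>2 / x)"
          using x i by (intro member_le_sum) auto
        moreover have "x * ((g i x t)\<^sup>2 * Q i x t) \<le> x * P x t"
          using x single_le_P[OF i] by (intro mult_left_mono) auto
        ultimately show "x * (gr i x t)\<^sup>2 + (gt i x t)\<^sup>2 / x + x * ((g i x t)\<^sup>2 * Q i x t)
          \<le> (\<Sum>i\<in>{1..k}. x * (gr i x t)\<^sup>2 + (gt i x t)\<^sup>2 / x) + x * P x t" by simp
      qed (use x in auto)
      then show ?thesis by simp
    qed
  qed
  moreover have "EE 0 = 0" "J i 0 = 0"
    by (simp_all add: EE_def J_def K_def gt_centre cint_const)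
  ultimately show ?thesis by simp
qed

lemma HH_deriv:
  assumes r: "0 < r" shows "(HH has_real_derivative 2 * (EE r + K r) / r) (at r)"
proof -
  have "(HH has_real_derivative (\<Sum>i\<in>{1..k}. 2 * J i r / r)) (at r)"
    unfolding HH_def[abs_def] by (intro DERIV_sum hh_deriv r)
  then show ?thesis
    by (simp add: EE_def sum_distrib_left sum_divide_distrib)
qed

lemma pohozaev:
  assumes r: "0 < r"
  shows "r * EE' r = 2 * cint (\<lambda>t. \<Sum>i\<in>{1..k}. r\<^sup>2 * (gr i r t)\<^sup>2) + 2 * K r"
proof -
  have "2 * K r = cint (\<lambda>t. (\<Sum>i\<in>{1..k}. (gt i r t)\<^sup>2 - r\<^sup>2 * (gr i r t)\<^sup>2) + r\<^sup>2 * P r t)"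
    unfolding K_def
    by (subst cint_add cint_sum | subst cint_cmult | intro continuous_intros cont_P_curried | simp)+
  also have "\<dots> = cint (\<lambda>t. r * ((\<Sum>i\<in>{1..k}. r * (gr i r t)\<^sup>2 + (gt i r t)\<^sup>2 / r) + r * P r t)
      - 2 * (\<Sum>i\<in>{1..k}. r\<^sup>2 * (gr i r t)\<^sup>2))"
    using r by (intro arg_cong[of _ _ cint] ext)
      (simp add: sum.distrib sum_subtractf sum_distrib_left algebra_simps power2_eq_square)
  also have "\<dots> = r * EE' r - 2 * cint (\<lambda>t. \<Sum>i\<in>{1..k}. r\<^sup>2 * (gr i r t)\<^sup>2)"
    unfolding EE'_def cint_cmult[symmetric] using r
    by (intro cint_diff continuous_intros cont_P_curried) auto
  finally show ?thesis by simp
qed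

text \<open>The right-hand side is the derivative of \<open>EE / HH\<close>. Besides the usual Cauchy--Schwarz term, which is nonnegative,
  the interaction contributes at least \<open>2 K / (r HH)\<close>, exactly the part of the logarithmic derivative of \<open>HH\<close> that
  \<open>EE / HH\<close> does not account for.\<close>

lemma almgren_derivative:
  assumes r: "0 < r" and H: "0 < HH r"
  shows "2 * K r / (r * HH r) \<le> (EE' r * HH r - EE r * (2 * (EE r + K r) / r)) / (HH r)\<^sup>2"
proof -
  let ?S = "EE r + K r" and ?A = "cint (\<lambda>t. \<Sum>i\<in>{1..k}. r\<^sup>2 * (gr i r t)\<^sup>2)"
  \<comment> \<open>The Cauchy--Schwarz inequality follows by integrating the squares of \<open>r \<partial>\<^sub>r g - q g\<close> for this optimal \<open>q\<close>.\<close>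
  define q where "q = ?S / HH r"
  have S: "?S = cint (\<lambda>t. \<Sum>i\<in>{1..k}. r * (g i r t * gr i r t))"
    unfolding EE_def J_def
    by (subst cint_sum | subst cint_cmult | intro continuous_intros | simp)+
  have HH: "HH r = cint (\<lambda>t. \<Sum>i\<in>{1..k}. (g i r t)\<^sup>2)"
    unfolding HH_def hh_def by (subst cint_sum) (intro continuous_intros | simp)+
  have "cint (\<lambda>t. 2 * q * (\<Sum>i\<in>{1..k}. r * (g i r t * gr i r t)) - q\<^sup>2 * (\<Sum>i\<in>{1..k}. (g i r t)\<^sup>2)) \<le> ?A"
  proof (intro cint_mono continuous_intros)
    fix t
    have "0 \<le> (\<Sum>i\<in>{1..k}. (r * gr i r t - q * g i r t)\<^sup>2)" by (intro sum_nonneg) auto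
    also have "\<dots> = (\<Sum>i\<in>{1..k}. r\<^sup>2 * (gr i r t)\<^sup>2) -
        (2 * q * (\<Sum>i\<in>{1..k}. r * (g i r t * gr i r t)) - q\<^sup>2 * (\<Sum>i\<in>{1..k}. (g i r t)\<^sup>2))"
      by (simp add: sum_distrib_left sum.distrib sum_subtractf power2_eq_square algebra_simps)
    finally show "2 * q * (\<Sum>i\<in>{1..k}. r * (g i r t * gr i r t)) - q\<^sup>2 * (\<Sum>i\<in>{1..k}. (g i r t)\<^sup>2)
      \<le> (\<Sum>i\<in>{1..k}. r\<^sup>2 * (gr i r t)\<^sup>2)" by simp
  qed
  also have "cint (\<lambda>t. 2 * q * (\<Sum>i\<in>{1..k}. r * (g i r t * gr i r t)) - q\<^sup>2 * (\<Sum>i\<in>{1..k}. (g i r t)\<^sup>2))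
      = 2 * q * ?S - q\<^sup>2 * HH r"
    unfolding S HH cint_cmult[symmetric] by (intro cint_diff continuous_intros)
  also have "\<dots> = ?S\<^sup>2 / HH r" using H by (simp add: q_def field_simps power2_eq_square)
  finally have A: "?S\<^sup>2 / HH r \<le> ?A" .
  have "0 \<le> ?S" unfolding EE_def using r by (auto intro!: sum_nonneg J_nonneg)
  then have KS: "0 \<le> K r * ?S" using K_nonneg r by simp
  have "2 * ?S\<^sup>2 / HH r + 2 * K r \<le> r * EE' r" using A pohozaev[OF r] by simp
  then have "(2 * ?S\<^sup>2 / HH r + 2 * K r) * HH r \<le> r * EE' r * HH r" using H by (intro mult_right_mono) auto
  then have "2 * ?S\<^sup>2 + 2 * K r * HH r \<le> r * EE' r * HH r" using H by (simp add: distrib_right)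
  moreover have "2 * ?S\<^sup>2 = 2 * EE r * ?S + 2 * (K r * ?S)" by (simp add: power2_eq_square algebra_simps)
  ultimately have "2 * K r * HH r \<le> r * EE' r * HH r - 2 * EE r * ?S" using KS by linarith
  then have "2 * K r * HH r / (r * (HH r)\<^sup>2) \<le> (r * EE' r * HH r - 2 * EE r * ?S) / (r * (HH r)\<^sup>2)"
    using r by (intro divide_right_mono) auto
  then show ?thesis using r H by (simp add: field_simps power2_eq_square)
qed

text \<open>By \<open>almgren_derivative\<close>, the function \<open>F = log HH - EE / HH - 2 b log r\<close> is nonincreasing.\<close>

lemma growth_bound:
  assumes R: "0 < R" "0 < HH R" and b: "\<And>r. R \<le> r \<Longrightarrow> EE r / HH r \<le> b" "0 \<le> b"
  obtains C where "\<And>r. R \<le> r \<Longrightarrow> EE r \<le> C * r powr (2 * b)"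
proof -
  have HHpos: "0 < HH r" if "R \<le> r" for r
  proof -
    have "HH R \<le> HH r" unfolding HH_def using R that by (intro sum_mono hh_mono) auto
    then show ?thesis using R by simp
  qed
  define F where "F r = ln (HH r) - EE r / HH r - 2 * b * ln r" for r
  have "F r \<le> F R" if r: "R \<le> r" for r
  proof (rule DERIV_nonpos_imp_nonincreasing[OF r])
    fix x assume x: "R \<le> x" "x \<le> r"
    have x0: "0 < x" and Hx: "0 < HH x" using x R HHpos by auto
    let ?N' = "(EE' x * HH x - EE x * (2 * (EE x + K x) / x)) / (HH x)\<^sup>2"
    let ?D = "(2 * (EE x + K x) / x) / HH x - ?N' - 2 * b / x"
    have "(F has_real_derivative ?D) (at x)"
      unfolding F_def[abs_def]
      using x0 Hx by (auto intro!: derivative_eq_intros HH_deriv EE_deriv simp: field_simps power2_eq_square)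
    moreover have "?D \<le> 0"
    proof -
      have "?D \<le> (2 * (EE x + K x) / x) / HH x - 2 * K x / (x * HH x) - 2 * b / x"
        using almgren_derivative[OF x0 Hx] by simp
      also have "\<dots> = 2 / x * (EE x / HH x - b)" using x0 Hx by (simp add: field_simps)
      also have "\<dots> \<le> 0" using b(1)[OF x(1)] x0 by (intro mult_nonneg_nonpos) auto
      finally show ?thesis .
    qed
    ultimately show "\<exists>y. (F has_real_derivative y) (at x) \<and> y \<le> 0" by blast
  qed
  note Fle = this
  show ?thesis
  proof (rule that[of "b * exp (F R + b)"])
    fix r assume r: "R \<le> r"
    have "ln (HH r) \<le> (F R + b) + 2 * b * ln r" using Fle[OF r] b(1)[OF r] by (simp add: F_def)
    then have "exp (ln (HH r)) \<le> exp ((F R + b) + 2 * b * ln r)" by simp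
    then have "HH r \<le> exp (F R + b) * r powr (2 * b)"
      using HHpos[OF r] R r by (simp add: exp_add powr_def)
    then have "b * HH r \<le> b * (exp (F R + b) * r powr (2 * b))" using b by (intro mult_left_mono)
    moreover have "EE r \<le> b * HH r" using b(1)[OF r] HHpos[OF r] by (simp add: divide_le_eq)
    ultimately show "EE r \<le> b * exp (F R + b) * r powr (2 * b)" by (simp add: mult.assoc)
  qed
qed

section \<open>The lower growth bound\<close>

text \<open>If the density vanished on the circle, \<open>u\<^sub>i\<close> would be a nonzero constant there, and the interaction term would make
  \<open>u\<^sub>j\<close> vanish on the circle.\<close>

lemma J'_pos:
  assumes i: "i \<in> {1..k}" and j: "j \<in> {1..k}" "j \<noteq> i" and r: "0 < r"
    and pos: "0 < hh i r" "0 < hh j r"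
  shows "0 < J' i r"
proof (rule ccontr)
  let ?f = "\<lambda>t. r * (gr i r t)\<^sup>2 + (gt i r t)\<^sup>2 / r + r * ((g i r t)\<^sup>2 * Q i r t)"
  assume "\<not> ?thesis"
  then have 0: "cint ?f = 0" using J'_nonneg[OF i r] by (simp add: J'_def)
  have parts: "0 \<le> r * (gr i r t)\<^sup>2" "0 \<le> (gt i r t)\<^sup>2 / r" "0 \<le> r * ((g i r t)\<^sup>2 * Q i r t)" for t
    using r Q_nonneg[OF i] by auto
  have "?f t = 0" if "t \<in> {0..2*pi}" for t
    by (rule cint_eq_0D[OF _ _ 0 that]) (use parts r i in \<open>auto intro!: continuous_intros add_nonneg_nonneg\<close>)
  then have z: "gt i r t = 0 \<and> (g i r t)\<^sup>2 * Q i r t = 0" if "t \<in> {0..2*pi}" for t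
    using that parts[of t] r by (smt (verit) divide_eq_0_iff mult_eq_0_iff zero_eq_power2)
  have const: "g i r t = g i r 0" if t: "t \<in> {0..2*pi}" for t
  proof -
    have "((\<lambda>s. g i r s) has_real_derivative 0) (at s within {0..2*pi})" if "s \<in> {0..2*pi}" for s
      using g_t[OF i, of r s] z[OF that] by (auto intro: has_field_derivative_at_within)
    then have "\<exists>c. \<forall>s\<in>{0..2*pi}. g i r s = c"
      by (intro has_field_derivative_zero_constant) auto
    then show ?thesis using t by force
  qed
  have "g i r 0 \<noteq> 0"
  proof
    assume "g i r 0 = 0"
    then have "g i r t = 0" if "t \<in> {0..2*pi}" for t using const[OF that] by simp
    then have "hh i r \<le> cint (\<lambda>t. 0)"
      unfolding hh_def by (intro cint_mono continuous_intros i) auto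
    then show False using pos by (simp add: cint_const)
  qed
  then have Q0: "Q i r t = 0" if "t \<in> {0..2*pi}" for t
    using z[OF that] const[OF that] by simp
  have "hh j r \<le> cint (\<lambda>t. 0)"
    unfolding hh_def
  proof (intro cint_mono continuous_intros j)
    fix t assume "t \<in> {0..2*pi}"
    moreover have "(g j r t)\<^sup>2 \<le> (\<Sum>j\<in>{1..k} - {i}. (g j r t)\<^sup>2)"
      by (rule member_le_sum) (use j in auto)
    ultimately show "(g j r t)\<^sup>2 \<le> 0" using Q0 by (simp add: Q_eq[OF i])
  qed
  then show False using pos by (simp add: cint_const)
qed

lemma J_pos:
  assumes i: "i \<in> {1..k}" and j: "j \<in> {1..k}" "j \<noteq> i" and R: "0 \<le> R" "R < r"
    and pos: "0 < hh i R" "0 < hh j R"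
  shows "0 < J i r"
proof -
  have "J i R < J i r"
  proof (rule DERIV_pos_imp_increasing_open[OF R(2)])
    show "\<exists>y. (J i has_real_derivative y) (at x) \<and> 0 < y" if "R < x" "x < r" for x
    proof -
      have "0 < x" "0 < hh i x" "0 < hh j x"
        using that R pos hh_mono[of i R x] hh_mono[of j R x] i j by auto
      then show ?thesis using J_deriv[OF i] J'_pos[OF i j] by blast
    qed
    show "continuous_on {R..r} (J i)"
      by (rule continuous_on_subset[OF continuous_profiles(2)[OF i]]) auto
  qed
  then show ?thesis using J_nonneg[OF i R(1)] by simp
qed

text \<open>The Rayleigh quotient of the normalised component \<open>i\<close> on the circle of radius \<open>r\<close>. The potential uses
  normalised competitors with the coupling constant \<open>c r\<^sup>2\<close>; this is a lower estimate of the true potential when \<open>c\<close>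
  bounds the masses \<open>hh j r\<close> from below.\<close>

definition rayleigh :: "real \<Rightarrow> nat set \<Rightarrow> nat \<Rightarrow> real \<Rightarrow> real" where
  "rayleigh c A i r = cint (\<lambda>t. (gt i r t / sqrt (hh i r))\<^sup>2 +
     c * r\<^sup>2 * (g i r t / sqrt (hh i r))\<^sup>2 * (\<Sum>j\<in>A - {i}. (g j r t / sqrt (hh j r))\<^sup>2))"

text \<open>The derivative of \<open>J i\<close> is at least a radial part plus the mass times the Rayleigh quotient over \<open>r\<close>; the inequality between
  arithmetic and geometric means bounds their sum by the boundary integral \<open>J i\<close>.\<close>

lemma rayleigh_bound:
  assumes A: "A \<subseteq> {1..k}" and i: "i \<in> A" and r: "0 < r" and c: "0 < c"
    and h: "\<And>j. j \<in> A \<Longrightarrow> c \<le> hh j r"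
  shows "2 * sqrt (rayleigh c A i r) * J i r / r \<le> J' i r"
proof -
  let ?L = "rayleigh c A i r"
  have ik: "i \<in> {1..k}" using A i by auto
  have hp: "0 < hh j r" if "j \<in> A" for j using h[OF that] c by simp
  have cj: "continuous_on UNIV (g j r)" if "j \<in> A" for j using that A by (intro continuous_intros) auto
  have L0: "0 \<le> ?L"
    unfolding rayleigh_def using ik c A hp[OF i]
    by (intro cint_nonneg continuous_intros cj) (auto intro!: add_nonneg_nonneg mult_nonneg_nonneg sum_nonneg dest: hp)
  have "hh i r * ?L \<le> cint (\<lambda>t. (gt i r t)\<^sup>2 + r\<^sup>2 * ((g i r t)\<^sup>2 * Q i r t))"
    unfolding rayleigh_def cint_cmult[symmetric]
  proof (intro cint_mono continuous_intros cj ik)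
    fix t
    have "c * (\<Sum>j\<in>A - {i}. (g j r t / sqrt (hh j r))\<^sup>2) \<le> (\<Sum>j\<in>A - {i}. (g j r t)\<^sup>2)"
      unfolding sum_distrib_left
    proof (rule sum_mono)
      fix j assume "j \<in> A - {i}"
      then have "c \<le> hh j r" "0 < hh j r" using h hp by auto
      then show "c * (g j r t / sqrt (hh j r))\<^sup>2 \<le> (g j r t)\<^sup>2"
        by (simp add: power_divide divide_le_eq mult.commute[of _ "hh j r"] mult_right_mono)
    qed
    also have "\<dots> \<le> Q i r t"
      unfolding Q_eq[OF ik] using A by (intro sum_mono2) auto
    finally have "r\<^sup>2 * (g i r t)\<^sup>2 * (c * (\<Sum>j\<in>A - {i}. (g j r t / sqrt (hh j r))\<^sup>2)) \<le> r\<^sup>2 * (g i r t)\<^sup>2 * Q i r t"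
      by (intro mult_left_mono) auto
    then show "hh i r * ((gt i r t / sqrt (hh i r))\<^sup>2 +
       c * r\<^sup>2 * (g i r t / sqrt (hh i r))\<^sup>2 * (\<Sum>j\<in>A - {i}. (g j r t / sqrt (hh j r))\<^sup>2))
       \<le> (gt i r t)\<^sup>2 + r\<^sup>2 * ((g i r t)\<^sup>2 * Q i r t)"
      using hp[OF i] by (simp add: power_divide distrib_left mult_ac)
  qed (use A hp i in \<open>force+\<close>)
  then have "1/r * (hh i r * ?L) \<le> 1/r * cint (\<lambda>t. (gt i r t)\<^sup>2 + r\<^sup>2 * ((g i r t)\<^sup>2 * Q i r t))"
    using r by (intro mult_left_mono) auto
  then have "r * cint (\<lambda>t. (gr i r t)\<^sup>2) + ?L / r * cint (\<lambda>t. (g i r t)\<^sup>2) \<le>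
      r * cint (\<lambda>t. (gr i r t)\<^sup>2) + 1/r * cint (\<lambda>t. (gt i r t)\<^sup>2 + r\<^sup>2 * ((g i r t)\<^sup>2 * Q i r t))"
    by (simp add: hh_def mult.commute)
  also have "\<dots> = cint (\<lambda>t. r * (gr i r t)\<^sup>2 + 1/r * ((gt i r t)\<^sup>2 + r\<^sup>2 * ((g i r t)\<^sup>2 * Q i r t)))"
    unfolding cint_cmult[symmetric] by (intro cint_add[symmetric] continuous_intros ik)
  also have "\<dots> = J' i r"
    unfolding J'_def using r
    by (intro arg_cong[of _ _ cint] ext) (simp add: field_simps power2_eq_square)
  finally have up: "r * cint (\<lambda>t. (gr i r t)\<^sup>2) + ?L / r * cint (\<lambda>t. (g i r t)\<^sup>2) \<le> J' i r" .
  have "2 * sqrt ?L * J i r / r = cint (\<lambda>t. 2 * sqrt ?L * (g i r t * gr i r t))"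
    using r by (simp add: J_def cint_cmult)
  also have "\<dots> \<le> cint (\<lambda>t. r * (gr i r t)\<^sup>2 + ?L / r * (g i r t)\<^sup>2)"
  proof (intro cint_mono continuous_intros ik)
    fix t
    have "0 \<le> (r * gr i r t - sqrt ?L * g i r t)\<^sup>2 / r" using r by simp
    also have "\<dots> = r * (gr i r t)\<^sup>2 + (sqrt ?L)\<^sup>2 / r * (g i r t)\<^sup>2 - 2 * sqrt ?L * (g i r t * gr i r t)"
      using r by (simp add: field_simps power2_eq_square)
    finally show "2 * sqrt ?L * (g i r t * gr i r t) \<le> r * (gr i r t)\<^sup>2 + ?L / r * (g i r t)\<^sup>2"
      using L0 by simp
  qed
  also have "\<dots> = r * cint (\<lambda>t. (gr i r t)\<^sup>2) + ?L / r * cint (\<lambda>t. (g i r t)\<^sup>2)"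
    unfolding cint_cmult[symmetric] by (intro cint_add continuous_intros ik)
  finally show ?thesis using up by simp
qed

text \<open>The masses \<open>hh i\<close> are nondecreasing, so from some radius on they have a common lower bound \<open>c > 0\<close>, and the coupling
  constant \<open>c r\<^sup>2\<close> eventually exceeds the threshold of \<open>optimal_partition_of_circle\<close>. The sum of the logarithmic
  derivatives of the \<open>J i\<close> is then at least \<open>(1 - e) m\<^sup>2 / r\<close>.\<close>

lemma acf_lower_bound:
  assumes A: "A \<subseteq> {1..k}" "2 \<le> card A" and e: "0 < e"
    and nn: "\<And>i r t. i \<in> A \<Longrightarrow> 0 \<le> g i r t"
    and nontriv: "\<And>i. i \<in> A \<Longrightarrow> \<exists>r\<ge>0. 0 < hh i r"
  obtains R C where "0 < R"
    "\<And>i r. i \<in> A \<Longrightarrow> R \<le> r \<Longrightarrow> 0 < J i r" "\<And>i r. i \<in> A \<Longrightarrow> R \<le> r \<Longrightarrow> 0 < hh i r"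
    "\<And>r. R \<le> r \<Longrightarrow> (1 - e) * (real (card A))\<^sup>2 * ln r - C \<le> (\<Sum>i\<in>A. ln (J i r))"
proof -
  let ?m = "real (card A)"
  have fin: "finite A" using A finite_subset by blast
  then have "A \<noteq> {}" using A by auto
  from nontriv obtain \<rho> where \<rho>: "\<And>i. i \<in> A \<Longrightarrow> 0 \<le> \<rho> i \<and> 0 < hh i (\<rho> i)" by metis
  define R0 where "R0 = Max (\<rho> ` A)"
  have R0: "0 \<le> R0" "\<And>i. i \<in> A \<Longrightarrow> \<rho> i \<le> R0"
    using \<rho> fin \<open>A \<noteq> {}\<close> by (auto simp: R0_def Max_ge_iff)
  have hR0: "0 < hh i R0" if "i \<in> A" for i
    using \<rho>[OF that] R0(2)[OF that] hh_mono[of i "\<rho> i" R0] that A by force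
  define c where "c = Min ((\<lambda>i. hh i R0) ` A)"
  have c: "0 < c" "\<And>i. i \<in> A \<Longrightarrow> c \<le> hh i R0"
    using hR0 fin \<open>A \<noteq> {}\<close> by (auto simp: c_def)
  have hc: "c \<le> hh i r" if "i \<in> A" "R0 \<le> r" for i r
    using c(2)[OF that(1)] hh_mono[of i R0 r] that R0(1) A by force
  obtain \<kappa>0 where \<kappa>0: "\<And>\<kappa> v v'. \<kappa> \<ge> \<kappa>0 \<Longrightarrow>
     (\<And>i t. i \<in> A \<Longrightarrow> (v i has_real_derivative v' i t) (at t)) \<Longrightarrow>
     (\<And>i. i \<in> A \<Longrightarrow> continuous_on UNIV (v' i)) \<Longrightarrow>
     (\<And>i. i \<in> A \<Longrightarrow> v i (2*pi) = v i 0) \<Longrightarrow>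
     (\<And>i t. i \<in> A \<Longrightarrow> 0 \<le> v i t) \<Longrightarrow>
     (\<And>i. i \<in> A \<Longrightarrow> cint (\<lambda>t. (v i t)\<^sup>2) = 1) \<Longrightarrow>
     (1 - e) * ?m\<^sup>2 / 2 \<le>
       (\<Sum>i\<in>A. sqrt (cint (\<lambda>t. (v' i t)\<^sup>2 + \<kappa> * (v i t)\<^sup>2 * (\<Sum>j\<in>A - {i}. (v j t)\<^sup>2))))"
    by (rule optimal_partition_of_circle[OF fin A(2) e]) blast
  define R where "R = R0 + 1 + \<bar>\<kappa>0\<bar> / c"
  have "0 \<le> \<bar>\<kappa>0\<bar> / c" using c by simp
  then have R: "1 \<le> R" "R0 < R" using R0 unfolding R_def by linarith+
  have eig: "(1 - e) * ?m\<^sup>2 / 2 \<le> (\<Sum>i\<in>A. sqrt (rayleigh c A i r))" if r: "R \<le> r" for r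
    unfolding rayleigh_def
  proof (rule \<kappa>0)
    have "\<kappa>0 \<le> c * (\<bar>\<kappa>0\<bar> / c)" using c by simp
    also have "\<dots> \<le> c * r" using r R0 c by (intro mult_left_mono) (auto simp: R_def)
    also have "\<dots> \<le> c * r\<^sup>2" using r R c by (intro mult_left_mono self_le_power) auto
    finally show "\<kappa>0 \<le> c * r\<^sup>2" .
  next
    fix i t assume i: "i \<in> A"
    have ik: "i \<in> {1..k}" using A i by auto
    have hp: "0 < hh i r" using hc[OF i, of r] c R r by simp
    show "((\<lambda>t. g i r t / sqrt (hh i r)) has_real_derivative gt i r t / sqrt (hh i r)) (at t)"
      using hp by (intro DERIV_cdivide g_t ik)
    show "continuous_on UNIV (\<lambda>t. gt i r t / sqrt (hh i r))"
      using hp by (intro continuous_intros ik) auto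
    show "g i r (2*pi) / sqrt (hh i r) = g i r 0 / sqrt (hh i r)" using periodic(1)[OF ik] by simp
    show "0 \<le> g i r t / sqrt (hh i r)" using nn[OF i] hp by simp
    have "cint (\<lambda>t. (g i r t / sqrt (hh i r))\<^sup>2) = cint (\<lambda>t. 1 / hh i r * (g i r t)\<^sup>2)"
      using hp by (simp add: power_divide)
    also have "\<dots> = 1" using hp by (simp only: cint_cmult) (simp add: hh_def)
    finally show "cint (\<lambda>t. (g i r t / sqrt (hh i r))\<^sup>2) = 1" .
  qed
  have Jp: "0 < J i r" if ir: "i \<in> A" "R \<le> r" for i r
  proof -
    have "A \<noteq> {i}" using A by auto
    then obtain j where "j \<in> A" "j \<noteq> i" using ir(1) by blast
    then show ?thesis using ir A R R0 hR0 by (intro J_pos[of i j R0]) auto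
  qed
  define F where "F r = (\<Sum>i\<in>A. ln (J i r)) - (1 - e) * ?m\<^sup>2 * ln r" for r
  have F: "F R \<le> F r" if r: "R \<le> r" for r
  proof (rule DERIV_nonneg_imp_nondecreasing[OF r])
    fix x assume x: "R \<le> x" "x \<le> r"
    have x0: "0 < x" using x R by simp
    have "(F has_real_derivative (\<Sum>i\<in>A. 1 / J i x * J' i x) - (1 - e) * ?m\<^sup>2 * (1 / x)) (at x)"
      unfolding F_def[abs_def]
    proof (intro DERIV_diff DERIV_sum DERIV_cmult)
      show "((\<lambda>r. ln (J i r)) has_real_derivative 1 / J i x * J' i x) (at x)" if "i \<in> A" for i
        by (rule DERIV_chain2[OF DERIV_ln_divide J_deriv]) (use Jp[OF that x(1)] that A x0 in auto)
      show "(ln has_real_derivative 1 / x) (at x)" by (rule DERIV_ln_divide[OF x0])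
    qed
    moreover have "(1 - e) * ?m\<^sup>2 * (1 / x) \<le> (\<Sum>i\<in>A. 1 / J i x * J' i x)"
    proof -
      have "(1 - e) * ?m\<^sup>2 * (1 / x) = 2 / x * ((1 - e) * ?m\<^sup>2 / 2)" by simp
      also have "\<dots> \<le> 2 / x * (\<Sum>i\<in>A. sqrt (rayleigh c A i x))"
        using x0 eig[OF x(1)] by (intro mult_left_mono) auto
      also have "\<dots> \<le> (\<Sum>i\<in>A. 1 / J i x * J' i x)"
        unfolding sum_distrib_left
      proof (rule sum_mono)
        fix i assume i: "i \<in> A"
        have "2 * sqrt (rayleigh c A i x) * J i x / x \<le> J' i x"
          using hc x R by (intro rayleigh_bound A i x0 c) auto
        then have "(2 * sqrt (rayleigh c A i x) * J i x / x) / J i x \<le> J' i x / J i x"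
          using Jp[OF i x(1)] by (intro divide_right_mono) auto
        then show "2 / x * sqrt (rayleigh c A i x) \<le> 1 / J i x * J' i x"
          using Jp[OF i x(1)] by simp
      qed
      finally show ?thesis .
    qed
    ultimately show "\<exists>y. (F has_real_derivative y) (at x) \<and> 0 \<le> y" by fastforce
  qed
  show ?thesis
  proof (rule that[of R "- F R"])
    show "0 < R" using R by simp
    show "0 < hh i r" if "i \<in> A" "R \<le> r" for i r using hc[OF that(1), of r] that R c by simp
    show "(1 - e) * ?m\<^sup>2 * ln r - (- F R) \<le> (\<Sum>i\<in>A. ln (J i r))" if "R \<le> r" for r
      using F[OF that] by (simp add: F_def)
  qed (rule Jp)
qed

text \<open>The exponent of the lower bound for the product of the \<open>J i\<close> cannot exceed that of the upper bound, since
  \<open>ln r\<close> is unbounded.\<close>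

lemma component_count_bound:
  assumes A: "A \<subseteq> {1..k}" "2 \<le> card A"
    and nn: "\<And>i r t. i \<in> A \<Longrightarrow> 0 \<le> g i r t"
    and nontriv: "\<And>i. i \<in> A \<Longrightarrow> \<exists>r\<ge>0. 0 < hh i r"
    and lim: "((\<lambda>r. EE r / HH r) \<longlongrightarrow> d) at_top" and d: "0 < d"
  shows "real (card A) \<le> 2 * d"
proof (rule field_le_epsilon)
  let ?m = "real (card A)"
  fix \<eta> :: real assume \<eta>: "0 < \<eta>"
  define e where "e = \<eta> / (2 + ?m)"
  have e: "0 < e" using \<eta> by (simp add: e_def)
  obtain R C where R: "0 < R" and Jp: "\<And>i r. i \<in> A \<Longrightarrow> R \<le> r \<Longrightarrow> 0 < J i r"
    and hp: "\<And>i r. i \<in> A \<Longrightarrow> R \<le> r \<Longrightarrow> 0 < hh i r"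
    and low: "\<And>r. R \<le> r \<Longrightarrow> (1 - e) * ?m\<^sup>2 * ln r - C \<le> (\<Sum>i\<in>A. ln (J i r))"
    using acf_lower_bound[OF A e nn nontriv] by metis
  have "eventually (\<lambda>r. EE r / HH r < d + e) at_top"
    using lim e by (intro order_tendstoD) auto
  then obtain R1 where R1: "\<And>r. R1 \<le> r \<Longrightarrow> EE r / HH r \<le> d + e"
    unfolding eventually_at_top_linorder by (meson less_imp_le)
  define R2 where "R2 = max R R1"
  have HHp: "0 < HH R2"
  proof -
    obtain i where i: "i \<in> A" using A by fastforce
    have "0 < hh i R2" using hp[OF i] by (simp add: R2_def)
    also have "hh i R2 \<le> HH R2"
      unfolding HH_def using A i hh_nonneg by (intro member_le_sum) auto
    finally show ?thesis .
  qed
  obtain C2 where up: "\<And>r. R2 \<le> r \<Longrightarrow> EE r \<le> C2 * r powr (2 * (d + e))"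
  proof (rule growth_bound[of R2 "d + e"])
    show "EE r / HH r \<le> d + e" if "R2 \<le> r" for r using R1 that by (simp add: R2_def)
  qed (use HHp R d e in \<open>auto simp: R2_def\<close>)
  have ineq: "((1 - e) * ?m\<^sup>2 - ?m * (2 * (d + e))) * ln r \<le> C + ?m * ln \<bar>C2\<bar>" if r: "R2 \<le> r" for r
  proof -
    have r0: "0 < r" "R \<le> r" using r R by (auto simp: R2_def)
    have "ln (J i r) \<le> ln \<bar>C2\<bar> + 2 * (d + e) * ln r" if i: "i \<in> A" for i
    proof -
      have "0 < J i r" using Jp[OF i r0(2)] .
      moreover have J: "J i r \<le> C2 * r powr (2 * (d + e))"
        using J_le_EE[of i r] up[OF r] i A r0 by force
      moreover have "0 < C2"
      proof (rule ccontr)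
        assume "\<not> 0 < C2"
        then have "C2 * r powr (2 * (d + e)) \<le> 0" by (intro mult_nonpos_nonneg) auto
        then show False using J \<open>0 < J i r\<close> by simp
      qed
      ultimately have "ln (J i r) \<le> ln (C2 * r powr (2 * (d + e)))" by simp
      also have "\<dots> = ln \<bar>C2\<bar> + 2 * (d + e) * ln r"
        using \<open>0 < C2\<close> r0 by (simp add: ln_mult ln_powr)
      finally show ?thesis .
    qed
    then have "(\<Sum>i\<in>A. ln (J i r)) \<le> (\<Sum>i\<in>A. ln \<bar>C2\<bar> + 2 * (d + e) * ln r)" by (rule sum_mono)
    then have "(\<Sum>i\<in>A. ln (J i r)) \<le> ?m * (ln \<bar>C2\<bar> + 2 * (d + e) * ln r)" by simp
    then have "(1 - e) * ?m\<^sup>2 * ln r - C \<le> ?m * (ln \<bar>C2\<bar> + 2 * (d + e) * ln r)"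
      using low[OF r0(2)] by linarith
    then show ?thesis by (simp add: algebra_simps)
  qed
  have "(1 - e) * ?m\<^sup>2 \<le> ?m * (2 * (d + e))"
  proof (rule ccontr)
    assume "\<not> ?thesis"
    then have pos: "0 < (1 - e) * ?m\<^sup>2 - ?m * (2 * (d + e))" (is "0 < ?b") by simp
    define r where "r = max R2 (exp ((C + ?m * ln \<bar>C2\<bar> + 1) / ?b))"
    have "(C + ?m * ln \<bar>C2\<bar> + 1) / ?b \<le> ln r"
    proof -
      have "exp ((C + ?m * ln \<bar>C2\<bar> + 1) / ?b) \<le> r" by (simp add: r_def)
      then show ?thesis by (metis exp_gt_zero less_le_trans ln_exp ln_le_cancel_iff)
    qed
    then have "C + ?m * ln \<bar>C2\<bar> + 1 \<le> ?b * ln r"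
      using pos by (simp only: pos_divide_le_eq mult.commute)
    then show False using ineq[of r] by (simp add: r_def)
  qed
  then have "?m * ((1 - e) * ?m) \<le> ?m * (2 * (d + e))" by (simp add: power2_eq_square mult_ac)
  then have "(1 - e) * ?m \<le> 2 * (d + e)" by (rule mult_left_le_imp_le) (use A in simp)
  then have "?m \<le> 2 * d + e * (2 + ?m)" by (simp add: algebra_simps)
  also have "e * (2 + ?m) = \<eta>" by (simp add: e_def add_nonneg_pos[THEN less_imp_neq, symmetric] divide_simps)
  finally show "?m \<le> 2 * d + \<eta>" .
qed

end

section \<open>Solutions in polar coordinates\<close>

lemma frechet_derivative_2:
  fixes f :: "real^2 \<Rightarrow> real"
  assumes "f differentiable (at x)"
  shows "frechet_derivative f (at x) h = h$1 * partial_deriv 1 f x + h$2 * partial_deriv 2 f x"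
proof -
  interpret linear "frechet_derivative f (at x)"
    by (rule linear_frechet_derivative[OF assms])
  have "h = h$1 *\<^sub>R axis 1 1 + h$2 *\<^sub>R axis 2 1"
    by (simp add: vec_eq_iff forall_2 axis_def)
  then have "frechet_derivative f (at x) h = frechet_derivative f (at x) (h$1 *\<^sub>R axis 1 1 + h$2 *\<^sub>R axis 2 1)"
    by simp
  also have "\<dots> = h$1 * partial_deriv 1 f x + h$2 * partial_deriv 2 f x"
    unfolding partial_deriv_def by (simp only: add scaleR real_scaleR_def)
  finally show ?thesis .
qed

definition radial_deriv :: "(real^2 \<Rightarrow> real) \<Rightarrow> real \<Rightarrow> real \<Rightarrow> real" where
  "radial_deriv f r t = cos t * partial_deriv 1 f (polar r t) + sin t * partial_deriv 2 f (polar r t)"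

definition angular_deriv :: "(real^2 \<Rightarrow> real) \<Rightarrow> real \<Rightarrow> real \<Rightarrow> real" where
  "angular_deriv f r t = r * (cos t * partial_deriv 2 f (polar r t) - sin t * partial_deriv 1 f (polar r t))"

lemma curve_deriv:
  fixes f :: "real^2 \<Rightarrow> real" and x y :: "real \<Rightarrow> real"
  assumes f: "f differentiable (at (vector [x s, y s]))"
    and x: "(x has_real_derivative x') (at s)" and y: "(y has_real_derivative y') (at s)"
  shows "((\<lambda>s. f (vector [x s, y s])) has_real_derivative
    x' * partial_deriv 1 f (vector [x s, y s]) + y' * partial_deriv 2 f (vector [x s, y s])) (at s)"
proof -
  have vec: "vector [a, b] = a *\<^sub>R axis 1 1 + b *\<^sub>R (axis 2 1 :: real^2)" for a b
    by (simp add: vec_eq_iff forall_2 axis_def)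
  have "((\<lambda>s. vector [x s, y s] :: real^2) has_derivative (\<lambda>h. vector [x' * h, y' * h])) (at s)"
    unfolding vec
    by (intro has_derivative_add has_derivative_scaleR_left x[unfolded has_field_derivative_def] y[unfolded has_field_derivative_def])
  moreover have "(f has_derivative frechet_derivative f (at (vector [x s, y s]))) (at (vector [x s, y s]))"
    using f frechet_derivative_works by blast
  ultimately have "((\<lambda>s. f (vector [x s, y s])) has_derivative
      (\<lambda>h. frechet_derivative f (at (vector [x s, y s])) (vector [x' * h, y' * h]))) (at s)"
    by (rule has_derivative_compose)
  then show ?thesis
    unfolding has_field_derivative_def frechet_derivative_2[OF f]
    by (rule has_derivative_eq_rhs) (auto simp: algebra_simps)
qed

lemma radial_deriv:
  assumes "\<And>x. f differentiable (at x)"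
  shows "((\<lambda>r. f (polar r t)) has_real_derivative radial_deriv f r t) (at r)"
  unfolding polar_def radial_deriv_def by (rule curve_deriv) (auto intro!: derivative_eq_intros assms)

lemma angular_deriv:
  assumes "\<And>x. f differentiable (at x)"
  shows "((\<lambda>t. f (polar r t)) has_real_derivative angular_deriv f r t) (at t)"
proof -
  have "((\<lambda>t. f (polar r t)) has_real_derivative
      - (r * sin t) * partial_deriv 1 f (polar r t) + r * cos t * partial_deriv 2 f (polar r t)) (at t)"
    unfolding polar_def by (rule curve_deriv) (auto intro!: derivative_eq_intros assms)
  then show ?thesis by (rule DERIV_cong) (simp add: angular_deriv_def algebra_simps)
qed

lemma polar_2pi: "polar r (2*pi) = polar r 0"
  by (simp add: polar_def)

text \<open>The radial and the angular unit vector form an orthonormal basis.\<close>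

lemma polar_gradient:
  assumes "r \<noteq> 0"
  shows "(norm (gradient f (polar r t)))\<^sup>2 = (radial_deriv f r t)\<^sup>2 + (angular_deriv f r t)\<^sup>2 / r\<^sup>2"
proof -
  let ?a = "partial_deriv 1 f (polar r t)" and ?b = "partial_deriv 2 f (polar r t)"
  have "(norm (gradient f (polar r t)))\<^sup>2 = ?a\<^sup>2 + ?b\<^sup>2"
    by (simp add: norm_vec_def L2_set_def sum_2 gradient_def)
  also have "\<dots> = (cos t * ?a + sin t * ?b)\<^sup>2 + (cos t * ?b - sin t * ?a)\<^sup>2"
    using sin_cos_squared_add[of t] by algebra
  also have "\<dots> = (radial_deriv f r t)\<^sup>2 + (angular_deriv f r t)\<^sup>2 / r\<^sup>2"
    using assms by (simp add: radial_deriv_def angular_deriv_def power_mult_distrib)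
  finally show ?thesis .
qed

lemma sum_pairs:
  fixes a :: "nat \<Rightarrow> real"
  shows "(\<Sum>i=1..k. \<Sum>j\<in>{i<..k}. a i * a j) = (\<Sum>i=1..k. a i * ((\<Sum>j=1..k. a j) - a i)) / 2"
proof -
  have "2 * (\<Sum>i=1..k. \<Sum>j\<in>{i<..k}. a i * a j) = (\<Sum>i=1..k. a i)\<^sup>2 - (\<Sum>i=1..k. (a i)\<^sup>2)"
  proof (induction k)
    case (Suc k)
    have "(\<Sum>i=1..Suc k. \<Sum>j\<in>{i<..Suc k}. a i * a j) = (\<Sum>i=1..k. (\<Sum>j\<in>{i<..k}. a i * a j) + a i * a (Suc k))"
    proof -
      have "{i<..Suc k} = insert (Suc k) {i<..k}" if "i \<in> {1..k}" for i using that by auto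
      then show ?thesis by (simp add: add.commute)
    qed
    also have "\<dots> = (\<Sum>i=1..k. \<Sum>j\<in>{i<..k}. a i * a j) + (\<Sum>i=1..k. a i) * a (Suc k)"
      by (simp add: sum.distrib sum_distrib_right)
    finally show ?case using Suc by (simp add: power2_eq_square algebra_simps)
  qed simp
  moreover have "(\<Sum>i=1..k. a i * ((\<Sum>j=1..k. a j) - a i)) = (\<Sum>i=1..k. a i)\<^sup>2 - (\<Sum>i=1..k. (a i)\<^sup>2)"
    by (simp add: right_diff_distrib sum_subtractf power2_eq_square sum_distrib_right)
  ultimately show ?thesis by simp
qed

text \<open>Only the partial derivatives of \<open>u\<^sub>i\<close> along the axes are given, so the second derivatives in polar coordinates
  are written out by the chain rule. In the Laplacian the mixed terms cancel without appeal to their symmetry.\<close>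

lemma polar_system_of_solution:
  assumes sol: "solution k u"
  shows "polar_system k (\<lambda>i r t. u i (polar r t)) (\<lambda>i. radial_deriv (u i)) (\<lambda>i. angular_deriv (u i))
    (\<lambda>i r t. cos t * radial_deriv (partial_deriv 1 (u i)) r t + sin t * radial_deriv (partial_deriv 2 (u i)) r t)
    (\<lambda>i r t. (cos t * partial_deriv 2 (u i) (polar r t) - sin t * partial_deriv 1 (u i) (polar r t))
       + r * (cos t * radial_deriv (partial_deriv 2 (u i)) r t - sin t * radial_deriv (partial_deriv 1 (u i)) r t))
    (\<lambda>i r t. r * (cos t * angular_deriv (partial_deriv 2 (u i)) r t - sin t * angular_deriv (partial_deriv 1 (u i)) r t
       - sin t * partial_deriv 2 (u i) (polar r t) - cos t * partial_deriv 1 (u i) (polar r t)))"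
proof
  fix i assume i: "i \<in> {1..k}"
  have C2: "C2 (u i)" using sol i by (simp add: solution_def)
  have d0: "\<And>x. u i differentiable (at x)" and d1: "\<And>j x. partial_deriv j (u i) differentiable (at x)"
    and c2: "\<And>j l. continuous_on UNIV (partial_deriv l (partial_deriv j (u i)))"
    using C2 by (auto simp: C2_def)
  have c0: "continuous_on UNIV (u i)" and c1: "\<And>j. continuous_on UNIV (partial_deriv j (u i))"
    using d0 d1 by (simp_all add: continuous_at_imp_continuous_on differentiable_imp_continuous_within)
  note comp = continuous_on_compose2[OF c0] continuous_on_compose2[OF c1] continuous_on_compose2[OF c2]
  note D = radial_deriv[OF d0] angular_deriv[OF d0] radial_deriv[OF d1] angular_deriv[OF d1]
  show "((\<lambda>r. u i (polar r t)) has_real_derivative radial_deriv (u i) r t) (at r)"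
    "((\<lambda>t. u i (polar r t)) has_real_derivative angular_deriv (u i) r t) (at t)" for r t
    by (rule D)+
  show "((\<lambda>r. radial_deriv (u i) r t) has_real_derivative cos t * radial_deriv (partial_deriv 1 (u i)) r t + sin t * radial_deriv (partial_deriv 2 (u i)) r t) (at r)" for r t
    unfolding radial_deriv_def[of "u i"] by (auto intro!: derivative_eq_intros D)
  show "((\<lambda>r. angular_deriv (u i) r t) has_real_derivative (cos t * partial_deriv 2 (u i) (polar r t) - sin t * partial_deriv 1 (u i) (polar r t))
       + r * (cos t * radial_deriv (partial_deriv 2 (u i)) r t - sin t * radial_deriv (partial_deriv 1 (u i)) r t)) (at r)" for r t
    unfolding angular_deriv_def[of "u i"] by (auto intro!: derivative_eq_intros D simp: algebra_simps)
  show "(angular_deriv (u i) r has_real_derivative r * (cos t * angular_deriv (partial_deriv 2 (u i)) r t - sin t * angular_deriv (partial_deriv 1 (u i)) r t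
       - sin t * partial_deriv 2 (u i) (polar r t) - cos t * partial_deriv 1 (u i) (polar r t))) (at t)" for r t
    unfolding angular_deriv_def[of "u i", abs_def] by (auto intro!: derivative_eq_intros D simp: algebra_simps)
  show "continuous_on UNIV (\<lambda>p. u i (polar (fst p) (snd p)))"
    by (intro continuous_intros comp) auto
  show "continuous_on UNIV (\<lambda>p. radial_deriv (u i) (fst p) (snd p))"
    "continuous_on UNIV (\<lambda>p. angular_deriv (u i) (fst p) (snd p))"
    "continuous_on UNIV (\<lambda>p. cos (snd p) * radial_deriv (partial_deriv 1 (u i)) (fst p) (snd p) + sin (snd p) * radial_deriv (partial_deriv 2 (u i)) (fst p) (snd p))"
    "continuous_on UNIV (\<lambda>p. (cos (snd p) * partial_deriv 2 (u i) (polar (fst p) (snd p)) - sin (snd p) * partial_deriv 1 (u i) (polar (fst p) (snd p)))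
       + fst p * (cos (snd p) * radial_deriv (partial_deriv 2 (u i)) (fst p) (snd p) - sin (snd p) * radial_deriv (partial_deriv 1 (u i)) (fst p) (snd p)))"
    "continuous_on UNIV (\<lambda>p. fst p * (cos (snd p) * angular_deriv (partial_deriv 2 (u i)) (fst p) (snd p) - sin (snd p) * angular_deriv (partial_deriv 1 (u i)) (fst p) (snd p)
       - sin (snd p) * partial_deriv 2 (u i) (polar (fst p) (snd p)) - cos (snd p) * partial_deriv 1 (u i) (polar (fst p) (snd p))))"
    unfolding radial_deriv_def angular_deriv_def by (intro continuous_intros comp; simp)+
  show "u i (polar r (2*pi)) = u i (polar r 0)" "radial_deriv (u i) r (2*pi) = radial_deriv (u i) r 0"
    "angular_deriv (u i) r (2*pi) = angular_deriv (u i) r 0" for r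
    by (simp_all add: radial_deriv_def angular_deriv_def polar_2pi)
  show "angular_deriv (u i) 0 t = 0" for t by (simp add: angular_deriv_def)
  show "r\<^sup>2 * (cos t * radial_deriv (partial_deriv 1 (u i)) r t + sin t * radial_deriv (partial_deriv 2 (u i)) r t)
     + r * radial_deriv (u i) r t
     + r * (cos t * angular_deriv (partial_deriv 2 (u i)) r t - sin t * angular_deriv (partial_deriv 1 (u i)) r t
       - sin t * partial_deriv 2 (u i) (polar r t) - cos t * partial_deriv 1 (u i) (polar r t))
     = r\<^sup>2 * (u i (polar r t) * (\<Sum>j\<in>{1..k} - {i}. (u j (polar r t))\<^sup>2))" for r t
  proof -
    let ?x = "polar r t"
    have "laplacian (u i) ?x = (\<Sum>j\<in>{1..k} - {i}. (u j ?x)\<^sup>2 * u i ?x)"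
      using sol i by (auto simp: solution_def)
    then have "partial_deriv 1 (partial_deriv 1 (u i)) ?x + partial_deriv 2 (partial_deriv 2 (u i)) ?x
      = u i ?x * (\<Sum>j\<in>{1..k} - {i}. (u j ?x)\<^sup>2)"
      by (simp add: laplacian_def sum_2 sum_distrib_left mult.commute)
    then show ?thesis
      unfolding radial_deriv_def angular_deriv_def using sin_cos_squared_add[of t] by algebra
  qed
qed

section \<open>The bound on the number of components\<close>

theorem theorem1p7:
  fixes k :: nat and u :: "nat \<Rightarrow> real^2 \<Rightarrow> real" and d :: real
  assumes "k \<ge> 2"
    and "(almgren_quotient k u \<longlongrightarrow> d) at_top"
    and "d > 0"
  shows "(nonnegative_solution k u \<longrightarrow> real (card (nontrivial_components k u)) \<le> 2 * d) \<and>
         (positive_solution k u \<longrightarrow> d \<ge> real k / 2)"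
proof -
  have main: "real (card (nontrivial_components k u)) \<le> 2 * d" if nonneg: "nonnegative_solution k u"
  proof -
    let ?A = "nontrivial_components k u"
    have sol: "solution k u" and nn: "\<And>i x. i \<in> {1..k} \<Longrightarrow> 0 \<le> u i x" and two: "2 \<le> card ?A"
      using nonneg by (auto simp: nonnegative_solution_def)
    interpret polar_system k "\<lambda>i r t. u i (polar r t)" "\<lambda>i. radial_deriv (u i)" "\<lambda>i. angular_deriv (u i)"
      "\<lambda>i r t. cos t * radial_deriv (partial_deriv 1 (u i)) r t + sin t * radial_deriv (partial_deriv 2 (u i)) r t"
      "\<lambda>i r t. (cos t * partial_deriv 2 (u i) (polar r t) - sin t * partial_deriv 1 (u i) (polar r t))
         + r * (cos t * radial_deriv (partial_deriv 2 (u i)) r t - sin t * radial_deriv (partial_deriv 1 (u i)) r t)"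
      "\<lambda>i r t. r * (cos t * angular_deriv (partial_deriv 2 (u i)) r t - sin t * angular_deriv (partial_deriv 1 (u i)) r t
         - sin t * partial_deriv 2 (u i) (polar r t) - cos t * partial_deriv 1 (u i) (polar r t))"
      by (rule polar_system_of_solution[OF sol])
    have cu: "continuous_on UNIV (u i)" "continuous_on UNIV (partial_deriv j (u i))" if "i \<in> {1..k}" for i j
      using sol that by (auto simp: solution_def C2_def continuous_at_imp_continuous_on differentiable_imp_continuous_within)
    have H_eq: "H k u r = HH r" if r: "0 < r" for r
    proof -
      let ?f = "\<lambda>t. (\<Sum>i=1..k. (u i (polar r t))\<^sup>2) * r"
      have c: "continuous_on UNIV ?f" by (intro continuous_intros cont_curried)
      have "set_integrable lborel {0..2*pi} ?f"
        unfolding set_integrable_def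
        by (rule borel_integrable_compact, simp, rule continuous_on_subset[OF c], simp)
      then have "circle_integral r (\<lambda>x. \<Sum>i=1..k. (u i x)\<^sup>2) = cint ?f"
        unfolding circle_integral_def cint_def polar_def[symmetric] by (rule set_borel_integral_eq_integral)
      also have "\<dots> = r * cint (\<lambda>t. \<Sum>i=1..k. (u i (polar r t))\<^sup>2)"
        by (subst cint_cmult[symmetric]) (simp add: mult.commute)
      also have "\<dots> = r * HH r"
        unfolding HH_def hh_def by (subst cint_sum) (intro continuous_intros cont_curried | simp)+
      finally show ?thesis using r by (simp add: H_def)
    qed
    have E_eq: "E k u r = EE r" if r: "0 < r" for r
    proof -
      let ?e = "\<lambda>x. (\<Sum>i=1..k. (norm (gradient (u i) x))\<^sup>2) + (\<Sum>i=1..k. \<Sum>j\<in>{i<..k}. (u i x)\<^sup>2 * (u j x)\<^sup>2)"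
      have "continuous_on UNIV (gradient (u i))" if "i \<in> {1..k}" for i
        unfolding gradient_def[abs_def] by (intro continuous_intros cu that)
      then have "continuous_on UNIV ?e"
        by (intro continuous_intros cu) auto
      then have "E k u r = integral {0..r} (\<lambda>s. cint (\<lambda>t. s * ?e (polar s t)))"
        unfolding E_def cint_def by (rule integral_ball_polar[OF _ r])
      also have "\<dots> = integral {0..r} EE'"
      \<comment> \<open>Leaving out the centre allows division by the radius.\<close>
      proof (rule integral_spike[of "{0}"])
        fix s assume "s \<in> {0..r} - {0}"
        then have s: "s \<noteq> 0" by simp
        show "EE' s = cint (\<lambda>t. s * ?e (polar s t))"
          unfolding EE'_def
        proof (intro arg_cong[of _ _ cint] ext)
          fix t
          have "(\<Sum>i=1..k. \<Sum>j\<in>{i<..k}. (u i (polar s t))\<^sup>2 * (u j (polar s t))\<^sup>2) = P s t"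
            unfolding P_def Q_def by (rule sum_pairs)
          moreover have "(\<Sum>i=1..k. s * (radial_deriv (u i) s t)\<^sup>2 + (angular_deriv (u i) s t)\<^sup>2 / s)
              = s * (\<Sum>i=1..k. (norm (gradient (u i) (polar s t)))\<^sup>2)"
            unfolding sum_distrib_left
            unfolding polar_gradient[OF s] using s
            by (intro sum.cong) (simp_all add: distrib_left power2_eq_square)
          ultimately show "(\<Sum>i=1..k. s * (radial_deriv (u i) s t)\<^sup>2 + (angular_deriv (u i) s t)\<^sup>2 / s) + s * P s t
              = s * ?e (polar s t)"
            by (simp only: distrib_left)
        qed
      qed simp
      also have "\<dots> = EE r - EE 0"
      proof (rule integral_unique, rule fundamental_theorem_of_calculus_interior)
        show "(EE has_vector_derivative EE' x) (at x)" if "x \<in> {0<..<r}" for x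
          using EE_deriv[of x] that by (simp add: has_real_derivative_iff_has_vector_derivative)
      qed (use r in \<open>auto intro: continuous_on_subset[OF continuous_EE]\<close>)
      finally show ?thesis
        by (simp add: EE_def J_def K_def gt_centre cint_const)
    qed
    show ?thesis
    proof (rule component_count_bound)
      show "?A \<subseteq> {1..k}" by (auto simp: nontrivial_components_def)
      show "0 \<le> u i (polar r t)" if "i \<in> ?A" for i r t
        using that nn by (auto simp: nontrivial_components_def)
      show "\<exists>r\<ge>0. 0 < hh i r" if i: "i \<in> ?A" for i
      proof -
        from i obtain x where x: "u i x \<noteq> 0" "i \<in> {1..k}" by (auto simp: nontrivial_components_def)
        obtain t where t: "0 \<le> t" "t < 2 * pi" "x = polar (norm x) t" by (rule polar_surj)
        then have "0 < hh i (norm x)" using x by (intro hh_pos[of i t]) auto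
        then show ?thesis by (intro exI[of _ "norm x"]) simp
      qed
      show "((\<lambda>r. EE r / HH r) \<longlongrightarrow> d) at_top"
      proof (rule Lim_transform_eventually[OF assms(2)])
        show "\<forall>\<^sub>F r in at_top. almgren_quotient k u r = EE r / HH r"
          using eventually_gt_at_top[of 0] by eventually_elim (simp add: almgren_quotient_def E_eq H_eq)
      qed
    qed (use two assms in auto)
  qed
  moreover have "real k / 2 \<le> d" if pos: "positive_solution k u"
  proof -
    have "u i 0 \<noteq> 0" if "i \<in> {1..k}" for i
      using pos that unfolding positive_solution_def by (metis less_irrefl)
    then have "nontrivial_components k u = {1..k}"
      unfolding nontrivial_components_def by blast
    moreover from this have "nonnegative_solution k u"
      using pos assms(1) by (auto simp: positive_solution_def nonnegative_solution_def less_imp_le)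
    ultimately show ?thesis using main by simp
  qed
  ultimately show ?thesis by blast
qed

end
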